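(* Let $c\in\mathbb{R}$ with $c<-3.75$. For every $\epsilon>0$ there exists $M>0$ such that for every $s\in\mathbb{C}$ with $\mathrm{Re}(s)>1/2+\epsilon$ and $|\mathrm{Im}(s)|>M$, and for every $u\in\mathcal{H}$, $$\mathcal{L}_s u=u\quad\Longrightarrow\quad u=0,$$ where $\mathcal{L}_s:\mathcal{H}\to\mathcal{H}$ is the Ruelle transfer operator on the Bergman space $\mathcal{H}$ associated to $f(z)=z^2+c$.
   Context: Let $f(z)=z^2+c$ and $\zeta_c=\frac{1+\sqrt{1-4c}}{2}$, the largest fixed point of $f$; for $c<-2$ one has $2<\zeta_c<-c$. Fix $R\in(\zeta_c,-c)$ and let $D(0,R)$ be the open disc of radius $R$ centred at $0$ in $\mathbb{C}$. Define on $D(0,R)$ the two inverse branches $g_+(z)=\sqrt{z-c}$ and $g_-(z)=-\sqrt{z-c}$, where the square root is the holomorphic branch on $\mathbb{C}\setminus(-\infty,0]$ that is positive on $(0,\infty)$. Put $D_\pm=g_\pm(D(0,R))$; then $\overline{D_\pm}\subset D(0,R)$, and $D_+$, $D_-$ are disjoint. The Bergman space is $\mathcal{H}=\{u\in L^2(D_+\cup D_-): u \text{ is holomorphic on } D_+\cup D_-\}$. For $i\in\{+,-\}$ let $[g_i']$ be the holomorphic extension to $D_+\cup D_-$ of the function $|g_i'|$ on $\mathbb{R}\cap(D_+\cup D_-)$, i.e. $[g_i'(z)]=\frac{1}{2\sqrt{z-c}}$, and let $[g_i'(z)]^s=\exp(s\log[g_i'(z)])$ with the logarithm real for real $z$.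 For $s\in\mathbb{C}$, the Ruelle transfer operator $\mathcal{L}_s:\mathcal{H}\to\mathcal{H}$ is $$\mathcal{L}_su(z)=\sum_{i\in\{+,-\}}[g_i'(z)]^s\,u(g_i(z)),\qquad z\in D_+\cup D_-.$$ *)

theory Defs
  imports "HOL-Complex_Analysis.Complex_Analysis"
begin

definition zeta_fix :: "real \<Rightarrow> real" where
  "zeta_fix c = (1 + sqrt (1 - 4 * c)) / 2"

datatype branch = Plus | Minus

(* On the complement of the closed negative half-axis, csqrt is the holomorphic square root
   that is positive on the positive half-axis.  For R < - c the translate of ball 0 R by - c
   lies in the right half-plane, so the branch cut is never met. *)
fun inv_branch :: "real \<Rightarrow> branch \<Rightarrow> complex \<Rightarrow> complex" where
  "inv_branch c Plus z = csqrt (z - of_real c)"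
| "inv_branch c Minus z = - csqrt (z - of_real c)"

definition branch_disc :: "real \<Rightarrow> real \<Rightarrow> branch \<Rightarrow> complex set" where
  "branch_disc c R i = inv_branch c i ` ball 0 R"

definition branch_dom :: "real \<Rightarrow> real \<Rightarrow> complex set" where
  "branch_dom c R = branch_disc c R Plus \<union> branch_disc c R Minus"

(* The holomorphic extension of the modulus of the derivative on the real line; see the lemmas
   ext_abs_deriv_real and ext_abs_deriv_holomorphic below.  It is the same function for both
   branches. *)
definition ext_abs_deriv :: "real \<Rightarrow> branch \<Rightarrow> complex \<Rightarrow> complex" where
  "ext_abs_deriv c i z = 1 / (2 * csqrt (z - of_real c))"

(* An element of the Bergman space is represented by its holomorphic representative on
   branch_dom c R, extended by 0 to all of the complex plane, so that equality of functions is
   equality in the space.  The measure lborel on the complex plane is the area measure. *)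
definition bergman_space :: "real \<Rightarrow> real \<Rightarrow> (complex \<Rightarrow> complex) set" where
  "bergman_space c R =
    {u. u holomorphic_on branch_dom c R
      \<and> set_integrable lborel (branch_dom c R) (\<lambda>z. (norm (u z))\<^sup>2)
      \<and> (\<forall>z. z \<notin> branch_dom c R \<longrightarrow> u z = 0)}"

definition transfer_op ::
    "real \<Rightarrow> real \<Rightarrow> complex \<Rightarrow> (complex \<Rightarrow> complex) \<Rightarrow> complex \<Rightarrow> complex" where
  "transfer_op c R s u z =
    (if z \<in> branch_dom c R
     then \<Sum>i\<in>{Plus, Minus}. exp (s * Ln (ext_abs_deriv c i z)) * u (inv_branch c i z)
     else 0)"

lemma Re_diff_pos:
  assumes "R < - c" "z \<in> ball 0 R"
  shows "0 < Re (z - of_real c)"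
  using assms abs_Re_le_cmod[of z] by auto

lemma Re_pos_not_nonpos: "0 < Re z \<Longrightarrow> z \<notin> \<real>\<^sub>\<le>\<^sub>0"
  by (auto simp: complex_nonpos_Reals_iff)

lemma Re_csqrt_pos:
  assumes "0 < Re z"
  shows "0 < Re (csqrt z)"
proof -
  have "0 < cmod z + Re z" using assms norm_ge_zero[of z] by linarith
  then show ?thesis by simp
qed

lemma Re_ext_abs_deriv_pos:
  assumes "R < - c" "z \<in> ball 0 R"
  shows "0 < Re (ext_abs_deriv c i z)"
proof -
  define w where "w = 2 * csqrt (z - of_real c)"
  have w: "0 < Re w"
    using Re_csqrt_pos[OF Re_diff_pos[OF assms]] by (simp add: w_def del: csqrt.sel)
  then have "0 < (Re w)\<^sup>2 + (Im w)\<^sup>2" by (simp add: add_pos_nonneg)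
  then have "0 < Re (1 / w)" using w by (simp add: Re_divide)
  then show ?thesis by (simp add: ext_abs_deriv_def w_def)
qed

lemma ext_abs_deriv_holomorphic:
  assumes "R < - c"
  shows "ext_abs_deriv c i holomorphic_on ball 0 R"
proof -
  have "(\<lambda>z. 1 / (2 * csqrt (z - of_real c))) holomorphic_on ball 0 R"
    using Re_diff_pos[OF assms] Re_csqrt_pos[OF Re_diff_pos[OF assms]]
    by (intro holomorphic_intros Re_pos_not_nonpos) force+
  then show ?thesis by (simp add: ext_abs_deriv_def[abs_def])
qed

lemma ext_abs_deriv_real:
  assumes "R < - c" "of_real x \<in> ball (0::complex) R"
  shows "ext_abs_deriv c i (of_real x) = of_real (norm (deriv (inv_branch c i) (of_real x)))"
proof -
  let ?z = "of_real x :: complex"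
  have pos: "0 < Re (?z - of_real c)" by (rule Re_diff_pos[OF assms])
  then have nn: "?z - of_real c \<notin> \<real>\<^sub>\<le>\<^sub>0" by (rule Re_pos_not_nonpos)
  have P: "((\<lambda>z. csqrt (z - of_real c)) has_field_derivative 1 / (2 * csqrt (?z - of_real c))) (at ?z)"
    using nn by (auto intro!: derivative_eq_intros)
  have M: "((\<lambda>z. - csqrt (z - of_real c)) has_field_derivative - (1 / (2 * csqrt (?z - of_real c)))) (at ?z)"
    by (rule DERIV_minus[OF P])
  have fe: "inv_branch c Plus = (\<lambda>z. csqrt (z - of_real c))"
    "inv_branch c Minus = (\<lambda>z. - csqrt (z - of_real c))" by auto
  have nd: "norm (deriv (inv_branch c i) ?z) = norm (1 / (2 * csqrt (?z - of_real c)))"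
    using DERIV_imp_deriv[OF P] DERIV_imp_deriv[OF M] by (cases i) (simp_all add: fe)
  have "csqrt (?z - of_real c) = of_real (sqrt (x - c))"
    using pos of_real_sqrt[of "x - c"] by simp
  then show ?thesis
    using pos unfolding nd by (simp add: ext_abs_deriv_def norm_divide norm_mult)
qed

lemma inv_branch_holomorphic:
  assumes "R < - c"
  shows "inv_branch c i holomorphic_on ball 0 R"
proof -
  have "(\<lambda>z. csqrt (z - of_real c)) holomorphic_on ball 0 R"
    "(\<lambda>z. - csqrt (z - of_real c)) holomorphic_on ball 0 R"
    using Re_diff_pos[OF assms] by (auto intro!: holomorphic_intros Re_pos_not_nonpos)
  moreover have "inv_branch c Plus = (\<lambda>z. csqrt (z - of_real c))"
    "inv_branch c Minus = (\<lambda>z. - csqrt (z - of_real c))" by auto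
  ultimately show ?thesis by (cases i) simp_all
qed

lemma inv_branch_square: "(inv_branch c i z)\<^sup>2 + of_real c = z"
  by (cases i) auto

lemma open_branch_dom:
  assumes "R < - c"
  shows "open (branch_dom c R)"
proof -
  have "inj_on (inv_branch c i) (ball 0 R)" for i
    by (metis inj_onI inv_branch_square)
  then have "open (branch_disc c R i)" for i
    unfolding branch_disc_def
    by (intro open_mapping_thm3 inv_branch_holomorphic assms open_ball)
  then show ?thesis unfolding branch_dom_def by (intro open_Un)
qed

lemma branch_dom_radius:
  assumes "c < - 2" "zeta_fix c < R" "R < - c"
  obtains r where "r < R" "branch_dom c R \<subseteq> cball 0 r"
proof
  have s0: "0 \<le> sqrt (1 - 4 * c)" using assms by simp
  have "sqrt (1 - 4 * c) < 2 * R - 1" using assms by (simp add: zeta_fix_def field_simps)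
  then have "(sqrt (1 - 4 * c))\<^sup>2 < (2 * R - 1)\<^sup>2" using s0 by (intro power_strict_mono) auto
  then have "R - c < R\<^sup>2" using assms(1) by (simp add: power2_eq_square algebra_simps)
  moreover have "0 < R" using s0 \<open>sqrt (1 - 4 * c) < 2 * R - 1\<close> by linarith
  ultimately show "sqrt (R - c) < R" by (simp add: real_less_lsqrt)
  have "norm (inv_branch c i z) \<le> sqrt (R - c)" if "z \<in> ball 0 R" for i z
  proof -
    have "norm (z - of_real c) \<le> R - c"
      using norm_triangle_ineq4[of z "of_real c"] that assms(1) by simp
    then show ?thesis by (cases i) auto
  qed
  then show "branch_dom c R \<subseteq> cball 0 (sqrt (R - c))"
    by (auto simp: branch_dom_def branch_disc_def simp del: inv_branch.simps)
qed

lemma transfer_op_in_bergman_space: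
  assumes "c < - 2" "zeta_fix c < R" "R < - c" and u: "u \<in> bergman_space c R"
  shows "transfer_op c R s u \<in> bergman_space c R"
proof -
  let ?D = "branch_dom c R"
  define v where "v z = (\<Sum>i\<in>{Plus, Minus}. exp (s * Ln (ext_abs_deriv c i z)) * u (inv_branch c i z))" for z
  obtain r where r: "r < R" "?D \<subseteq> cball 0 r" using branch_dom_radius[OF assms(1-3)] .
  then have sub: "cball 0 r \<subseteq> ball (0::complex) R" by auto
  have img: "inv_branch c i ` ball 0 R \<subseteq> ?D" for i
    by (cases i) (auto simp: branch_dom_def branch_disc_def)
  have uhol: "u holomorphic_on ?D" using u by (simp add: bergman_space_def)
  have comp: "(\<lambda>z. u (inv_branch c i z)) holomorphic_on ball 0 R" for i
    using holomorphic_on_compose_gen[OF inv_branch_holomorphic[OF assms(3)] uhol img]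
    by (simp add: o_def)
  have vhol: "v holomorphic_on ball 0 R"
    unfolding v_def
    using Re_ext_abs_deriv_pos[OF assms(3)]
    by (intro holomorphic_intros comp ext_abs_deriv_holomorphic[OF assms(3)] Re_pos_not_nonpos) auto
  have eq: "transfer_op c R s u z = v z" if "z \<in> ?D" for z
    using that by (simp add: transfer_op_def v_def)
  have "v holomorphic_on ?D" using vhol r(2) sub by (meson holomorphic_on_subset subset_trans)
  then have hol: "transfer_op c R s u holomorphic_on ?D"
    by (rule holomorphic_transform) (simp add: eq)
  have "continuous_on (cball 0 r) (\<lambda>z. (norm (v z))\<^sup>2)"
    using holomorphic_on_imp_continuous_on[OF vhol] sub
    by (intro continuous_intros) (auto elim: continuous_on_subset)
  then have "set_integrable lborel (cball 0 r) (\<lambda>z. (norm (v z))\<^sup>2)"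
    using borel_integrable_compact[of "cball (0::complex) r" "\<lambda>z. (norm (v z))\<^sup>2"]
    by (simp add: set_integrable_def)
  then have "set_integrable lborel ?D (\<lambda>z. (norm (v z))\<^sup>2)"
    by (rule set_integrable_subset) (use r open_branch_dom[OF assms(3)] in auto)
  then have "set_integrable lborel ?D (\<lambda>z. (norm (transfer_op c R s u z))\<^sup>2)"
    by (subst set_integrable_cong[OF refl refl]) (simp_all add: eq)
  with hol show ?thesis by (simp add: bergman_space_def transfer_op_def)
qed

end

theory Submission
  imports Defs
begin

text \<open>
  A fixed point \<open>u\<close> of the transfer operator extends to a holomorphic function \<open>U\<close> on the
  disc, and it suffices to show that \<open>U\<close> vanishes on a real interval \<open>I = [-b, b]\<close> with \<open>b\<close> slightly
  larger than the fixed point \<open>\<zeta>\<close>. There \<open>U = Y + Z\<close>, where \<open>Y\<close> and \<open>Z\<close> are the contributions of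
  the two inverse branches. At \<open>Re s = 1/2\<close> the change of variables formula makes both pieces isometric
  in \<open>L\<^sup>2\<close>, so that for \<open>Re s > 1/2\<close> the diagonal part of \<open>\<parallel>Y + Z\<parallel>\<^sup>2\<close> is strictly smaller than
  \<open>\<parallel>U\<parallel>\<^sup>2\<close>, and it remains to see that the cross term \<open>\<langle>Y, Z\<rangle>\<close> is negligible for large
  \<open>t = Im s\<close>. Iterating \<open>n\<close> times, \<open>Y\<close> and \<open>Z\<close> become sums over words of oscillating terms
  with frequencies \<open>t\<close> times the logarithmic derivatives of the iterated branches; for \<open>c < -3.75\<close> the
  frequencies occurring in \<open>Y\<close> are uniformly separated from those occurring in \<open>Z\<close> at every point.
  One integration by parts gains \<open>1/t\<close> and costs a derivative of \<open>U\<close>, of size \<open>O(t)\<close>,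
  multiplied by the contraction rate \<open>(5/11)\<^sup>n\<close> of the words. Since Cauchy-Schwarz over the words only
  loses \<open>2\<^sup>n\<close>, a large \<open>n\<close> followed by a large \<open>t\<close> makes the cross term small.
\<close>

section \<open>Oscillatory integrals and cutoffs\<close>

lemma has_vector_derivative_exp_ii:
  fixes \<psi> :: "real \<Rightarrow> real"
  assumes "(\<psi> has_real_derivative d) (at x)"
  shows "((\<lambda>x. exp (- (\<i> * of_real (t * \<psi> x)))) has_vector_derivative
          - (\<i> * of_real (t * d)) * exp (- (\<i> * of_real (t * \<psi> x)))) (at x)"
proof -
  have 1: "((\<lambda>x. complex_of_real (\<psi> x)) has_vector_derivative of_real d) (at x)"
    using assms by (intro has_vector_derivative_of_real)
  have 2: "((\<lambda>z. exp (- (\<i> * of_real t * z))) has_field_derivative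
      - (\<i> * of_real t) * exp (- (\<i> * of_real t * of_real (\<psi> x)))) (at (complex_of_real (\<psi> x)))"
    by (auto intro!: derivative_eq_intros)
  show ?thesis
    using field_vector_diff_chain_at[OF 1 2] by (simp add: o_def algebra_simps)
qed

text \<open>Integration by parts: differentiating \<open>F * E / \<psi>'\<close> reproduces
  \<open>F * E\<close> with a factor \<open>t\<close>, and the boundary terms vanish. The bound is
  an integral of norms and not a supremum, so that it can later be summed over words by
  Cauchy-Schwarz.\<close>

lemma nonstationary_phase:
  fixes F F' :: "real \<Rightarrow> complex" and \<psi> \<psi>' \<psi>'' :: "real \<Rightarrow> real"
  assumes ab: "a \<le> b" and \<kappa>: "0 < \<kappa>"
    and F: "\<And>x. x \<in> {a..b} \<Longrightarrow> (F has_vector_derivative F' x) (at x)"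
    and \<psi>: "\<And>x. x \<in> {a..b} \<Longrightarrow> (\<psi> has_real_derivative \<psi>' x) (at x)"
    and \<psi>': "\<And>x. x \<in> {a..b} \<Longrightarrow> (\<psi>' has_real_derivative \<psi>'' x) (at x)"
    and cF': "continuous_on {a..b} F'" and c\<psi>'': "continuous_on {a..b} \<psi>''"
    and low: "\<And>x. x \<in> {a..b} \<Longrightarrow> \<kappa> \<le> \<psi>' x"
    and up: "\<And>x. x \<in> {a..b} \<Longrightarrow> \<bar>\<psi>'' x\<bar> \<le> K"
    and F0: "F a = 0" "F b = 0"
  shows "\<bar>t\<bar> * norm (integral {a..b} (\<lambda>x. F x * exp (- (\<i> * of_real (t * \<psi> x)))))
    \<le> integral {a..b} (\<lambda>x. norm (F' x) / \<kappa> + K * norm (F x) / \<kappa>\<^sup>2)"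
proof -
  define E where "E = (\<lambda>x. exp (- (\<i> * of_real (t * \<psi> x))))"
  \<comment> \<open>\<open>r\<close> is the derivative of \<open>1 / \<psi>'\<close>, and
    \<open>Q\<close> collects the terms in which the derivative does not fall on
    \<open>E\<close>.\<close>
  define r where "r = (\<lambda>x. - \<psi>'' x / (\<psi>' x)\<^sup>2)"
  define Q where "Q = (\<lambda>x. (F' x / of_real (\<psi>' x) + F x * of_real (r x)) * E x)"
  have cont: "continuous_on {a..b} F" "continuous_on {a..b} \<psi>" "continuous_on {a..b} \<psi>'"
    using has_vector_derivative_continuous[OF F] DERIV_isCont[OF \<psi>] DERIV_isCont[OF \<psi>']
    by (simp_all add: continuous_at_imp_continuous_on)
  have pos: "0 < \<psi>' x" if "x \<in> {a..b}" for x using low[OF that] \<kappa> by linarith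
  have cE: "continuous_on {a..b} E"
    unfolding E_def by (intro continuous_intros cont)
  have cr: "continuous_on {a..b} r"
    unfolding r_def using pos by (intro continuous_intros cont c\<psi>'') fastforce+
  have cQ: "continuous_on {a..b} Q"
    unfolding Q_def using pos by (intro continuous_intros cont cE cr cF') fastforce+
  have der: "((\<lambda>x. F x * of_real (1 / \<psi>' x) * E x) has_vector_derivative
      Q x - \<i> * of_real t * (F x * E x)) (at x)" if x: "x \<in> {a..b}" for x
  proof -
    have "((\<lambda>x. 1 / \<psi>' x) has_real_derivative r x) (at x)"
      using \<psi>'[OF x] pos[OF x]
      by (auto intro!: derivative_eq_intros simp: r_def power2_eq_square)
    then have 1: "((\<lambda>x. complex_of_real (1 / \<psi>' x)) has_vector_derivative of_real (r x)) (at x)"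
      by (intro has_vector_derivative_of_real)
    have 2: "(E has_vector_derivative - (\<i> * of_real (t * \<psi>' x)) * E x) (at x)"
      unfolding E_def by (rule has_vector_derivative_exp_ii[OF \<psi>[OF x]])
    have "of_real (1 / \<psi>' x) * complex_of_real (t * \<psi>' x) = of_real t"
      using pos[OF x] by simp
    then have "of_real (1 / \<psi>' x) * (F x * (\<i> * complex_of_real (t * \<psi>' x) * E x))
        = \<i> * of_real t * (F x * E x)"
      by (metis mult.assoc mult.left_commute)
    moreover have "(F x * of_real (r x) + F' x * of_real (1 / \<psi>' x)) * E x = Q x"
      by (simp add: Q_def algebra_simps)
    ultimately have 3: "(F x * of_real (1 / \<psi>' x)) * (- (\<i> * of_real (t * \<psi>' x)) * E x)
        + (F x * of_real (r x) + F' x * of_real (1 / \<psi>' x)) * E x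
      = Q x - \<i> * of_real t * (F x * E x)"
      by (simp only: mult_minus_left mult_minus_right mult_ac uminus_add_conv_diff)
    show ?thesis
      by (rule has_vector_derivative_eq_rhs[OF _ 3])
        (rule has_vector_derivative_mult[OF has_vector_derivative_mult[OF F[OF x] 1] 2])
  qed
  have "((\<lambda>x. Q x - \<i> * of_real t * (F x * E x)) has_integral
      F b * of_real (1 / \<psi>' b) * E b - F a * of_real (1 / \<psi>' a) * E a) {a..b}"
    by (rule fundamental_theorem_of_calculus[OF ab has_vector_derivative_at_within[OF der]])
  then have z: "((\<lambda>x. Q x - \<i> * of_real t * (F x * E x)) has_integral 0) {a..b}"
    by (simp add: F0)
  have "(Q has_integral integral {a..b} Q) {a..b}"
    by (intro integrable_integral integrable_continuous_interval cQ)
  from has_integral_diff[OF this z]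
  have "((\<lambda>x. \<i> * of_real t * (F x * E x)) has_integral integral {a..b} Q) {a..b}"
    by simp
  then have "\<i> * of_real t * integral {a..b} (\<lambda>x. F x * E x) = integral {a..b} Q"
    by (simp only: integral_unique flip: integral_mult_right)
  then have "\<bar>t\<bar> * norm (integral {a..b} (\<lambda>x. F x * E x)) = norm (integral {a..b} Q)"
    by (metis mult_1 norm_ii norm_mult norm_of_real)
  also have "\<dots> \<le> integral {a..b} (\<lambda>x. norm (F' x) / \<kappa> + K * norm (F x) / \<kappa>\<^sup>2)"
  proof (rule integral_norm_bound_integral)
    show "(\<lambda>x. norm (F' x) / \<kappa> + K * norm (F x) / \<kappa>\<^sup>2) integrable_on {a..b}"
      by (intro integrable_continuous_interval continuous_intros cont cF') (use \<kappa> in auto)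
    fix x assume x: "x \<in> {a..b}"
    have nE: "norm (E x) = 1" by (simp add: E_def norm_exp_eq_Re)
    have "norm (F' x / of_real (\<psi>' x)) \<le> norm (F' x) / \<kappa>"
      using low[OF x] \<kappa> pos[OF x] by (auto simp: norm_divide intro!: frac_le)
    moreover have "\<bar>r x\<bar> \<le> K / \<kappa>\<^sup>2"
      using up[OF x] low[OF x] \<kappa> by (auto simp: r_def abs_divide intro!: frac_le power_mono)
    then have "norm (F x * of_real (r x)) \<le> norm (F x) * (K / \<kappa>\<^sup>2)"
      unfolding norm_mult norm_of_real by (intro mult_left_mono) auto
    ultimately show "norm (Q x) \<le> norm (F' x) / \<kappa> + K * norm (F x) / \<kappa>\<^sup>2"
      using norm_triangle_ineq[of "F' x / of_real (\<psi>' x)" "F x * of_real (r x)"]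
      by (simp add: Q_def norm_mult nE mult.commute)
  qed (intro integrable_continuous_interval cQ)
  finally show ?thesis by (simp add: E_def)
qed

section \<open>Cutoff functions of class C1\<close>

lemma DERIV_max_0_power2:
  "((\<lambda>x::real. (max 0 x)\<^sup>2) has_real_derivative 2 * max 0 x) (at x)"
proof -
  consider "x < 0" | "x > 0" | "x = 0" by linarith
  then show ?thesis
  proof cases
    case 1
    have "((\<lambda>x::real. 0) has_real_derivative 2 * max 0 x) (at x)" using 1 by simp
    then show ?thesis
      by (rule has_field_derivative_transform_within_open[of _ _ _ "{..<0}"]) (use 1 in auto)
  next
    case 2
    have "((\<lambda>x::real. x\<^sup>2) has_real_derivative 2 * max 0 x) (at x)"
      using 2 by (auto intro!: derivative_eq_intros)
    then show ?thesis
      by (rule has_field_derivative_transform_within_open[of _ _ _ "{0<..}"]) (use 2 in auto)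
  next
    case 3
    \<comment> \<open>At the kink the difference quotient is \<open>max 0 h\<close>, which tends to
      0.\<close>
    have "((\<lambda>h::real. max 0 h) \<longlongrightarrow> 0) (at 0)"
      using tendsto_max[OF tendsto_const[of "0::real"] tendsto_ident_at[of 0 UNIV]] by simp
    moreover have "(max 0 h)\<^sup>2 / h = max 0 h" for h :: real
      by (simp add: max_def power2_eq_square)
    ultimately show ?thesis using 3 by (simp add: has_field_derivative_iff)
  qed
qed

text \<open>One integration by parts calls for one continuous derivative, so a quadratic drop
  outside \<open>[-M, M]\<close> is enough. The plateau will be the hull of the images of the two
  branches.\<close>

lemma C1_cutoff:
  fixes M b :: real
  assumes "0 < M" "M < b"
  obtains \<eta> \<eta>' :: "real \<Rightarrow> real"
  where "\<And>x. (\<eta> has_real_derivative \<eta>' x) (at x)" "continuous_on UNIV \<eta>'"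
    "\<And>x. \<bar>x\<bar> \<le> b \<Longrightarrow> 0 \<le> \<eta> x \<and> \<eta> x \<le> 1" "\<And>x. \<bar>x\<bar> \<le> M \<Longrightarrow> \<eta> x = 1"
    "\<eta> b = 0" "\<eta> (- b) = 0"
proof
  define \<eta> where "\<eta> = (\<lambda>x. 1 - ((max 0 (x - M))\<^sup>2 + (max 0 (- x - M))\<^sup>2) / (b - M)\<^sup>2)"
  define \<eta>' where "\<eta>' = (\<lambda>x. - ((2 * max 0 (x - M) - 2 * max 0 (- x - M)) / (b - M)\<^sup>2))"
  show "(\<eta> has_real_derivative \<eta>' x) (at x)" for x
  proof -
    have 1: "((\<lambda>x. (max 0 (x - M))\<^sup>2) has_real_derivative 2 * max 0 (x - M) * 1) (at x)"
      by (rule DERIV_chain2[OF DERIV_max_0_power2]) (auto intro!: derivative_eq_intros)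
    have 2: "((\<lambda>x. (max 0 (- x - M))\<^sup>2) has_real_derivative 2 * max 0 (- x - M) * - 1) (at x)"
      by (rule DERIV_chain2[OF DERIV_max_0_power2]) (auto intro!: derivative_eq_intros)
    show ?thesis
      unfolding \<eta>_def \<eta>'_def
      using DERIV_diff[OF DERIV_const[of 1] DERIV_cdivide[OF DERIV_add[OF 1 2], of "(b - M)\<^sup>2"]]
      by simp
  qed
  show "continuous_on UNIV \<eta>'"
    unfolding \<eta>'_def using assms by (intro continuous_intros) auto
  show "0 \<le> \<eta> x \<and> \<eta> x \<le> 1" if "\<bar>x\<bar> \<le> b" for x
  proof -
    \<comment> \<open>As \<open>M > 0\<close>, at most one of the two positive parts is
      nonzero.\<close>
    have *: "(max 0 (x - M))\<^sup>2 + (max 0 (- x - M))\<^sup>2 = (max 0 (\<bar>x\<bar> - M))\<^sup>2"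
      using assms by (auto simp: max_def abs_if)
    have "(max 0 (\<bar>x\<bar> - M))\<^sup>2 \<le> (b - M)\<^sup>2"
      using assms that by (intro power_mono) auto
    then show ?thesis
      unfolding \<eta>_def * using assms by (simp add: field_simps)
  qed
qed (use assms in \<open>auto simp: max_def\<close>)

section \<open>Sums of integrals and elementary inequalities\<close>

lemma integral_double_sum:
  fixes f :: "'a \<Rightarrow> 'b \<Rightarrow> real \<Rightarrow> 'c::euclidean_space"
  assumes "finite A" "finite B" "\<And>a b. a \<in> A \<Longrightarrow> b \<in> B \<Longrightarrow> continuous_on {l..u} (f a b)"
  shows "integral {l..u} (\<lambda>x. \<Sum>a\<in>A. \<Sum>b\<in>B. f a b x) =
    (\<Sum>a\<in>A. \<Sum>b\<in>B. integral {l..u} (f a b))"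
proof -
  have *: "f a b integrable_on {l..u}" if "a \<in> A" "b \<in> B" for a b
    using assms(3)[OF that] by (rule integrable_continuous_interval)
  have "integral {l..u} (\<lambda>x. \<Sum>a\<in>A. \<Sum>b\<in>B. f a b x) =
    (\<Sum>a\<in>A. integral {l..u} (\<lambda>x. \<Sum>b\<in>B. f a b x))"
    using * assms by (intro integral_sum integrable_sum)
  also have "\<dots> = (\<Sum>a\<in>A. \<Sum>b\<in>B. integral {l..u} (f a b))"
    using * assms by (intro sum.cong refl integral_sum)
  finally show ?thesis .
qed

lemma sq_norm_add_le: "(norm (u + v))\<^sup>2 \<le> 2 * ((norm u)\<^sup>2 + (norm v)\<^sup>2)"
  for u v :: "'a::real_normed_vector"
proof -
  have "(norm (u + v))\<^sup>2 \<le> (norm u + norm v)\<^sup>2"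
    by (intro power_mono norm_triangle_ineq) auto
  also have "\<dots> \<le> 2 * ((norm u)\<^sup>2 + (norm v)\<^sup>2)"
    using zero_le_power2[of "norm u - norm v"] by (simp add: power2_eq_square algebra_simps)
  finally show ?thesis .
qed

text \<open>With \<open>l = L x\<close> the factor \<open>exp (- l)\<close> is the Jacobian of a
  branch, to be absorbed by a change of variables. The other factor is the gain over the critical
  exponent 1/2.\<close>

lemma sq_exp_half: "(exp (- (r * l)))\<^sup>2 = exp (- ((2 * r - 1) * l)) * exp (- l)" for r l :: real
  by (simp add: power2_eq_square exp_add[symmetric] algebra_simps)

lemma norm_exp_L: "norm (exp (- (s * complex_of_real l))) = exp (- (Re s * l))"
  by simp


section \<open>The inverse branches on a real interval\<close>

text \<open>
  The second assumption on \<open>b\<close> says that \<open>b\<close> lies beyond the fixed point \<open>\<zeta>\<close>, so that the branches map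
  the interval strictly into itself. The third is compatible with it exactly when \<open>c < -3.75\<close>.
\<close>
locale quadratic_interval =
  fixes c b :: real
  assumes c: "c < - 3.75" and b_pos: "0 < b" and b_outside: "b - c < b\<^sup>2"
    and b_upper: "3 * b \<le> - 2 * c"
begin

definition g :: "real \<Rightarrow> real" where "g x = sqrt (x - c)"

text \<open>Minus the logarithm of the derivative \<open>1 / (2 * g x)\<close>, so that the weight
  of the transfer operator is \<open>exp (- (s * L x))\<close>.\<close>

definition L :: "real \<Rightarrow> real" where "L x = ln (2 * g x)"

abbreviation I :: "real set" where "I \<equiv> {- b..b}"

text \<open>The images of \<open>I\<close> under the branches \<open>g\<close> and
  \<open>- g\<close> are \<open>[m, M]\<close> and \<open>[-M, -m]\<close>.\<close>

definition m :: real where "m = sqrt (- b - c)"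
definition M :: real where "M = sqrt (b - c)"

lemma I_gt: "x \<in> I \<Longrightarrow> c < x"
  using c b_upper by simp

text \<open>The bound on \<open>b\<close> gives \<open>- b - c \<ge> - c / 3 > 1.25\<close>, which
  exceeds 1.21. Branch derivatives are thus at most 5/11 in modulus, less than the 1/2 that would
  merely balance the doubling of the number of words at each step.\<close>

lemma m_pos: "11 / 10 < m"
proof -
  have "(11 / 10)\<^sup>2 < - b - c" using c b_upper by (simp add: power2_eq_square)
  then show ?thesis unfolding m_def by (rule real_less_rsqrt)
qed

lemma mM: "m \<le> M" "M < b"
proof -
  show "m \<le> M" using b_pos by (simp add: m_def M_def)
  show "M < b" unfolding M_def using b_pos b_outside by (intro real_less_lsqrt) auto
qed

lemma g_bounds: "x \<in> I \<Longrightarrow> m \<le> g x" "x \<in> I \<Longrightarrow> g x \<le> M"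
  by (auto simp: m_def M_def g_def)

lemma g_gt: "x \<in> I \<Longrightarrow> 11 / 10 < g x"
  using g_bounds(1) m_pos by force

lemma g_sq: "x \<in> I \<Longrightarrow> (g x)\<^sup>2 = x - c"
  using I_gt[of x] by (simp add: g_def)

lemma g_in_I: "x \<in> I \<Longrightarrow> g x \<in> I" "x \<in> I \<Longrightarrow> - g x \<in> I"
  using g_bounds(2)[of x] g_gt[of x] mM(2) by auto

lemma sg_in_I: "x \<in> I \<Longrightarrow> e = 1 \<or> e = - 1 \<Longrightarrow> e * g x \<in> I"
  using g_in_I by auto

lemma DERIV_g:
  assumes "x \<in> I" shows "(g has_real_derivative 1 / (2 * g x)) (at x)"
  unfolding g_def[abs_def] using I_gt[OF assms]
  by (auto intro!: derivative_eq_intros simp: field_simps)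

lemma DERIV_L:
  assumes "x \<in> I" shows "(L has_real_derivative 1 / (2 * (x - c))) (at x)"
proof -
  have "((\<lambda>x. ln (2 * g x)) has_real_derivative (1 / (2 * g x)) * (2 * (1 / (2 * g x)))) (at x)"
    using g_gt[OF assms]
    by (intro DERIV_chain2[OF DERIV_ln_divide] DERIV_cmult DERIV_g assms) auto
  moreover have "(1 / (2 * g x)) * (2 * (1 / (2 * g x))) = 1 / (2 * (x - c))"
    by (simp add: g_sq[OF assms, symmetric] power2_eq_square)
  ultimately show ?thesis by (simp add: L_def[abs_def])
qed

lemma exp_L: "x \<in> I \<Longrightarrow> exp (- L x) = 1 / (2 * g x)"
  using g_gt[of x] by (simp add: L_def exp_minus inverse_eq_divide)

lemma weight_le: "x \<in> I \<Longrightarrow> exp (- L x) \<le> 5 / 11"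
  using g_gt[of x] by (simp add: exp_L field_simps)

lemma L_pos: "x \<in> I \<Longrightarrow> 0 < L x"
  using g_gt[of x] by (simp add: L_def)

lemma cont_g: "continuous_on I g"
  using DERIV_g by (meson DERIV_isCont continuous_at_imp_continuous_on)

lemma cont_L: "continuous_on I L"
  using DERIV_L by (meson DERIV_isCont continuous_at_imp_continuous_on)

lemma cont_comp_g:
  assumes "continuous_on I f" "e = 1 \<or> e = - 1"
  shows "continuous_on I (\<lambda>x. f (e * g x))"
proof (rule continuous_on_compose2[OF assms(1)])
  show "continuous_on I (\<lambda>x. e * g x)" by (intro continuous_intros cont_g)
  show "(\<lambda>x. e * g x) ` I \<subseteq> I" using sg_in_I[OF _ assms(2)] by blast
qed

section \<open>Change of variables for the transfer operator\<close>

text \<open>The transfer operator at \<open>s = 1\<close>.\<close>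
definition push :: "(real \<Rightarrow> real) \<Rightarrow> real \<Rightarrow> real" where
  "push P x = exp (- L x) * (P (g x) + P (- g x))"

lemma cont_push: "continuous_on I P \<Longrightarrow> continuous_on I (push P)"
  unfolding push_def[abs_def]
  using cont_comp_g[of P 1] cont_comp_g[of P "-1"]
  by (auto intro!: continuous_intros cont_L)

lemma push_nonneg: "(\<And>y. y \<in> I \<Longrightarrow> 0 \<le> P y) \<Longrightarrow> x \<in> I \<Longrightarrow> 0 \<le> push P x"
  using g_in_I by (simp add: push_def)

text \<open>The weight is exactly the Jacobian of the substitution \<open>y = g x\<close>, so each
  branch contributes the integral over its own image.\<close>

lemma has_integral_push:
  assumes P: "continuous_on I P"
  shows "(push P has_integral (integral {- M..- m} P + integral {m..M} P)) I"
proof -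
  have P': "continuous_on I (\<lambda>y. P (- y))"
    by (rule continuous_on_compose2[OF P]) (auto intro!: continuous_intros)
  have one: "((\<lambda>x. (1 / (2 * g x)) *\<^sub>R f (g x)) has_integral integral {m..M} f) I"
    if "continuous_on I f" for f :: "real \<Rightarrow> real"
  proof -
    have "((\<lambda>x. (1 / (2 * g x)) *\<^sub>R f (g x)) has_integral integral {g (- b)..g b} f) I"
      by (rule has_integral_substitution[where c = "- b" and d = b])
        (use b_pos g_in_I that DERIV_g in
          \<open>auto simp: g_def[of b] g_def[of "-b"] intro: has_field_derivative_at_within\<close>)
    then show ?thesis by (simp add: g_def m_def M_def)
  qed
  have "((\<lambda>x. (1 / (2 * g x)) *\<^sub>R P (- g x) + (1 / (2 * g x)) *\<^sub>R P (g x)) has_integral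
      integral {m..M} (\<lambda>y. P (- y)) + integral {m..M} P) I"
    by (intro has_integral_add one[OF P] one[OF P'])
  moreover have "integral {m..M} (\<lambda>y. P (- y)) = integral {- M..- m} P"
    using Henstock_Kurzweil_Integration.integral_reflect_real[of "- m" "- M" P] by simp
  ultimately have *: "((\<lambda>x. (1 / (2 * g x)) *\<^sub>R P (- g x) + (1 / (2 * g x)) *\<^sub>R P (g x)) has_integral
      integral {- M..- m} P + integral {m..M} P) I" by simp
  show ?thesis
    by (rule has_integral_eq[OF _ *]) (simp add: push_def exp_L algebra_simps)
qed

lemma integral_outer_le:
  fixes Q :: "real \<Rightarrow> real"
  assumes Q: "continuous_on I Q" and nn: "\<And>y. y \<in> I \<Longrightarrow> 0 \<le> Q y"
  shows "integral {- M..- m} Q + integral {m..M} Q \<le> integral I Q"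
proof -
  have sub: "{- M..- m} \<union> {m..M} \<subseteq> I" using mM m_pos by auto
  have "Q integrable_on J" if "J \<subseteq> I" "J = {u..v}" for J u v
    unfolding that(2)
    by (rule integrable_continuous_interval[OF continuous_on_subset[OF Q that(1)[unfolded that(2)]]])
  then have int: "Q integrable_on {- M..- m}" "Q integrable_on {m..M}" "Q integrable_on I"
    using sub by (simp_all del: atLeastatMost_subset_iff)
  have "{- M..- m} \<inter> {m..M} = {}" using m_pos by auto
  then have "(Q has_integral integral {- M..- m} Q + integral {m..M} Q) ({- M..- m} \<union> {m..M})"
    using int by (intro has_integral_Un) (auto simp: integrable_integral)
  then show ?thesis
    using has_integral_subset_le[OF sub _ integrable_integral[OF int(3)]] nn by blast
qed

lemma integral_push_le:
  assumes P: "continuous_on I P" and nn: "\<And>y. y \<in> I \<Longrightarrow> 0 \<le> P y"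
  shows "integral I (push P) \<le> integral I P"
  using integral_unique[OF has_integral_push[OF P]] integral_outer_le[OF P nn] by simp

text \<open>Both images of \<open>I\<close> lie where \<open>\<eta>\<close> is 1, so inserting the
  cutoff costs nothing. This is what lets the final estimate close up on the cut-off norm.\<close>

lemma integral_push_le_cutoff:
  fixes \<eta> :: "real \<Rightarrow> real"
  assumes P: "continuous_on I P" and nn: "\<And>y. y \<in> I \<Longrightarrow> 0 \<le> P y"
    and \<eta>: "continuous_on I \<eta>" "\<And>x. \<bar>x\<bar> \<le> b \<Longrightarrow> 0 \<le> \<eta> x" "\<And>x. \<bar>x\<bar> \<le> M \<Longrightarrow> \<eta> x = 1"
  shows "integral I (push P) \<le> integral I (\<lambda>x. \<eta> x * P x)"
proof -
  have "integral {- M..- m} P = integral {- M..- m} (\<lambda>x. \<eta> x * P x)"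
    "integral {m..M} P = integral {m..M} (\<lambda>x. \<eta> x * P x)"
    using m_pos mM by (auto intro!: integral_cong simp: \<eta>(3))
  then have "integral I (push P) =
      integral {- M..- m} (\<lambda>x. \<eta> x * P x) + integral {m..M} (\<lambda>x. \<eta> x * P x)"
    using integral_unique[OF has_integral_push[OF P]] by simp
  also have "\<dots> \<le> integral I (\<lambda>x. \<eta> x * P x)"
    using nn \<eta> by (intro integral_outer_le continuous_intros P) auto
  finally show ?thesis .
qed

end

section \<open>Iterated branches and separation of frequencies\<close>

text \<open>The letters are the signs themselves as real numbers, so that a letter can multiply
  \<open>g x\<close> directly.\<close>

primrec words :: "nat \<Rightarrow> real list set" where
  "words 0 = {[]}"
| "words (Suc n) = (#) 1 ` words n \<union> (#) (- 1) ` words n"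

lemma finite_words: "finite (words n)"
  by (induction n) auto

lemma set_words: "w \<in> words n \<Longrightarrow> set w \<subseteq> {1, - 1}"
  by (induction n arbitrary: w) force+

lemma length_words: "w \<in> words n \<Longrightarrow> length w = n"
  by (induction n arbitrary: w) auto

lemma sum_words_Suc:
  fixes f :: "real list \<Rightarrow> 'a::comm_monoid_add"
  shows "sum f (words (Suc n)) = (\<Sum>w\<in>words n. f (1 # w)) + (\<Sum>w\<in>words n. f (- 1 # w))"
  by (subst words.simps, subst sum.union_disjoint)
    (auto simp: finite_words sum.reindex)

lemma card_words: "card (words n) = 2 ^ n"
  using sum_words_Suc[of "\<lambda>_. 1::nat"] by (induction n) auto

context quadratic_interval
begin

text \<open>
  The word \<open>e # w\<close> stands for the branch \<open>e * g\<close> followed by the branches in \<open>w\<close>. Then \<open>S w\<close> is the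
  negative logarithm of the modulus of \<open>G' w\<close>, and \<open>D w\<close> is the derivative of \<open>S w\<close>.
\<close>
primrec G :: "real list \<Rightarrow> real \<Rightarrow> real" where
  "G [] = (\<lambda>x. x)"
| "G (e # w) = (\<lambda>x. G w (e * g x))"

primrec G' :: "real list \<Rightarrow> real \<Rightarrow> real" where
  "G' [] = (\<lambda>x. 1)"
| "G' (e # w) = (\<lambda>x. G' w (e * g x) * (e * (1 / (2 * g x))))"

primrec S :: "real list \<Rightarrow> real \<Rightarrow> real" where
  "S [] = (\<lambda>x. 0)"
| "S (e # w) = (\<lambda>x. L x + S w (e * g x))"

primrec D :: "real list \<Rightarrow> real \<Rightarrow> real" where
  "D [] = (\<lambda>x. 0)"
| "D (e # w) = (\<lambda>x. 1 / (2 * (x - c)) + D w (e * g x) * (e * (1 / (2 * g x))))"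

lemma G_in_I: "set w \<subseteq> {1, - 1} \<Longrightarrow> x \<in> I \<Longrightarrow> G w x \<in> I"
proof (induction w arbitrary: x)
  case (Cons e w)
  then show ?case using sg_in_I[of x e] by simp
qed simp

lemma DERIV_sg:
  assumes "x \<in> I" shows "((\<lambda>x. e * g x) has_real_derivative e * (1 / (2 * g x))) (at x)"
  by (rule DERIV_cmult[OF DERIV_g[OF assms]])

lemma DERIV_G:
  "set w \<subseteq> {1, - 1} \<Longrightarrow> x \<in> I \<Longrightarrow> (G w has_real_derivative G' w x) (at x)"
proof (induction w arbitrary: x)
  case (Cons e w)
  then have "e * g x \<in> I" using sg_in_I[of x e] by simp
  with Cons have "(G w has_real_derivative G' w (e * g x)) (at (e * g x))" by simp
  from DERIV_chain2[OF this DERIV_sg] Cons.prems show ?case by simp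
qed simp

lemma cont_G': "set w \<subseteq> {1, - 1} \<Longrightarrow> continuous_on I (G' w)"
proof (induction w)
  case (Cons e w)
  have "g x \<noteq> 0" if "x \<in> I" for x using g_gt[OF that] by simp
  with Cons show ?case
    by (auto intro!: continuous_intros cont_comp_g[of "G' w"] cont_g)
qed simp

lemma abs_G':
  "set w \<subseteq> {1, - 1} \<Longrightarrow> x \<in> I \<Longrightarrow> \<bar>G' w x\<bar> = exp (- S w x)"
proof (induction w arbitrary: x)
  case (Cons e w)
  then have "e * g x \<in> I" using sg_in_I[of x e] by simp
  moreover have "\<bar>e\<bar> = 1" using Cons by auto
  moreover have "exp (- L x - S w (e * g x)) = exp (- L x) * exp (- S w (e * g x))"
    by (simp add: exp_add[symmetric])
  ultimately show ?case
    using Cons g_gt[of x] by (simp add: abs_mult exp_L)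
qed simp

lemma S_nonneg: "set w \<subseteq> {1, - 1} \<Longrightarrow> x \<in> I \<Longrightarrow> 0 \<le> S w x"
proof (induction w arbitrary: x)
  case (Cons e w)
  then have "0 \<le> S w (e * g x)" using sg_in_I[of x e] by simp
  then show ?case using L_pos[of x] Cons by simp
qed simp

lemma exp_S_le:
  "set w \<subseteq> {1, - 1} \<Longrightarrow> x \<in> I \<Longrightarrow> exp (- S w x) \<le> (5 / 11) ^ length w"
proof (induction w arbitrary: x)
  case (Cons e w)
  then have "exp (- S w (e * g x)) \<le> (5 / 11) ^ length w" using sg_in_I[of x e] by simp
  then have "exp (- L x) * exp (- S w (e * g x)) \<le> 5 / 11 * (5 / 11) ^ length w"
    using weight_le[of x] Cons.prems(2) by (intro mult_mono) auto
  then show ?case by (simp add: exp_add[symmetric])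
qed simp

lemma DERIV_S:
  "set w \<subseteq> {1, - 1} \<Longrightarrow> x \<in> I \<Longrightarrow> (S w has_real_derivative D w x) (at x)"
proof (induction w arbitrary: x)
  case (Cons e w)
  then have "e * g x \<in> I" using sg_in_I[of x e] by simp
  with Cons have "(S w has_real_derivative D w (e * g x)) (at (e * g x))" by simp
  from DERIV_add[OF DERIV_L DERIV_chain2[OF this DERIV_sg]] Cons.prems show ?case by simp
qed simp

lemma cont_G: "set w \<subseteq> {1, - 1} \<Longrightarrow> continuous_on I (G w)"
  using DERIV_G by (meson DERIV_isCont continuous_at_imp_continuous_on)

lemma cont_S: "set w \<subseteq> {1, - 1} \<Longrightarrow> continuous_on I (S w)"
  using DERIV_S by (meson DERIV_isCont continuous_at_imp_continuous_on)

text \<open>Differentiate the recursion for \<open>D\<close> by induction on the word. A bound on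
  \<open>D2\<close> may depend on the word, because the word length is fixed before
  \<open>Im s\<close> grows.\<close>

lemma D_C1:
  assumes "set w \<subseteq> {1, - 1}"
  obtains D2 where "\<And>x. x \<in> I \<Longrightarrow> (D w has_real_derivative D2 x) (at x)" "continuous_on I D2"
proof -
  have "\<exists>D2. (\<forall>x\<in>I. (D w has_real_derivative D2 x) (at x)) \<and> continuous_on I D2"
    using assms
  proof (induction w)
    case (Cons e w)
    then have "\<exists>D2. (\<forall>x\<in>I. (D w has_real_derivative D2 x) (at x)) \<and> continuous_on I D2"
      by simp
    then obtain D2 where D2: "\<And>x. x \<in> I \<Longrightarrow> (D w has_real_derivative D2 x) (at x)"
      "continuous_on I D2" by blast
    have e: "e = 1 \<or> e = - 1" using Cons by auto
    have gnz: "g x \<noteq> 0" "x \<noteq> c" if "x \<in> I" for x using g_gt[OF that] I_gt[OF that] by auto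
    \<comment> \<open>The derivative of the recursive clause of \<open>D\<close>; the derivative of
      \<open>1 / (2 * g)\<close> is \<open>- 1 / (4 * g ^ 3)\<close>.\<close>
    define H where "H x = - 1 / (2 * (x - c)\<^sup>2) +
      (D2 (e * g x) * (e * (1 / (2 * g x))) * (e * (1 / (2 * g x)))
        + (- e / (4 * (g x) ^ 3)) * D w (e * g x))" for x
    have 1: "(D (e # w) has_real_derivative H x) (at x)" if x: "x \<in> I" for x
    proof -
      have a: "((\<lambda>x. 1 / (2 * (x - c))) has_real_derivative - 1 / (2 * (x - c)\<^sup>2)) (at x)"
      proof -
        have "((\<lambda>x. 2 * (x - c)) has_real_derivative 2) (at x)"
          by (auto intro!: derivative_eq_intros)
        from DERIV_divide[OF DERIV_const[of 1] this]
        have "((\<lambda>x. 1 / (2 * (x - c))) has_real_derivative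
            (0 * (2 * (x - c)) - 1 * 2) / ((2 * (x - c)) * (2 * (x - c)))) (at x)"
          using gnz[OF x] by simp
        moreover have "(0 * (2 * y) - 1 * 2) / ((2 * y) * (2 * y)) = - 1 / (2 * y\<^sup>2)" for y :: real
          by (simp add: power2_eq_square)
        ultimately show ?thesis by (simp only:)
      qed
    have b: "((\<lambda>x. D w (e * g x)) has_real_derivative D2 (e * g x) * (e * (1 / (2 * g x)))) (at x)"
        by (rule DERIV_chain2[OF D2(1) DERIV_sg]) (use x e sg_in_I in auto)
      have c: "((\<lambda>x. e * (1 / (2 * g x))) has_real_derivative - e / (4 * (g x) ^ 3)) (at x)"
        using gnz[OF x] by (auto intro!: derivative_eq_intros DERIV_g[OF x]
            simp: field_simps power2_eq_square power3_eq_cube)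
      show ?thesis using DERIV_add[OF a DERIV_mult[OF b c]] by (simp add: H_def)
    qed
    have "continuous_on I (D w)"
      using D2(1) by (meson DERIV_isCont continuous_at_imp_continuous_on)
    with D2(2) e have "continuous_on I H"
      unfolding H_def[abs_def] using gnz
      by (intro continuous_intros cont_comp_g[of D2] cont_comp_g[of "D w"] cont_g) auto
    with 1 show ?case by blast
  qed (auto intro!: exI[of _ "\<lambda>_. 0"])
  then show ?thesis using that by blast
qed

lemma cont_D: "set w \<subseteq> {1, - 1} \<Longrightarrow> continuous_on I (D w)"
  by (erule D_C1) (meson DERIV_isCont continuous_at_imp_continuous_on)

section \<open>Bounds for the frequencies\<close>

text \<open>
  The normalised frequency \<open>h w y = 1 + y * D w y\<close> satisfies the affine recursion
  \<open>h (e # w) y = 1 + a y * h w (e * g y)\<close> with \<open>a y = y / (2 * (y - c))\<close>. As \<open>-1 \<le> a \<le> 1/5\<close> on the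
  interval, \<open>[-1/4, 5/4]\<close> is invariant.
\<close>
lemma coeff_bounds:
  assumes "y \<in> I"
  shows "- 1 \<le> y / (2 * (y - c))" "y / (2 * (y - c)) \<le> 1 / 5"
proof -
  have "- y \<le> 2 * (y - c)" "5 * y \<le> 2 * (y - c)" "0 < y - c"
    using assms b_upper I_gt by auto
  then show "- 1 \<le> y / (2 * (y - c))" "y / (2 * (y - c)) \<le> 1 / 5"
    by (simp_all add: field_simps)
qed

text \<open>The two signs of \<open>a\<close> are treated separately. The choice
  \<open>A = 1\<close> gives the invariance of \<open>[-1/4, 5/4]\<close> under
  \<open>h \<mapsto> 1 + a * h\<close>; a smaller \<open>A\<close> gives a better lower
  bound.\<close>

lemma coeff_mult_bounds:
  fixes a h A :: real
  assumes "- A \<le> a" "a \<le> 1 / 5" "- 1 / 4 \<le> h" "h \<le> 5 / 4" "1 / 5 \<le> A" "A \<le> 1"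
  shows "- (5 / 4 * A) \<le> a * h \<and> a * h \<le> 1 / 4"
proof (cases "0 \<le> a")
  case True
  then have "a * h \<le> a * (5 / 4)" "a * (- 1 / 4) \<le> a * h"
    using assms by (intro mult_left_mono; simp)+
  then show ?thesis using assms by argo
next
  case False
  then have "a * (5 / 4) \<le> a * h" "a * h \<le> a * (- 1 / 4)"
    using assms by (intro mult_left_mono_neg; simp)+
  then show ?thesis using assms by argo
qed

text \<open>The identity \<open>g y ^ 2 = y - c\<close> turns the factor
  \<open>e / (2 * g y)\<close> into \<open>e * g y / (2 * (y - c))\<close>, so that
  \<open>1 / (2 * (y - c))\<close> can be pulled out.\<close>

lemma D_Cons:
  assumes "y \<in> I"
  shows "D (e # w) y = 1 / (2 * (y - c)) * (1 + (e * g y) * D w (e * g y))"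
proof -
  have "e * (1 / (2 * g y)) = 1 / (2 * (y - c)) * (e * g y)"
    using g_sq[OF assms, symmetric] g_gt[OF assms] by (simp add: power2_eq_square)
  then have "D (e # w) y = 1 / (2 * (y - c)) + D w (e * g y) * (1 / (2 * (y - c)) * (e * g y))"
    by (simp only: D.simps)
  then show ?thesis by (simp only: distrib_left mult_1_right mult_ac)
qed

lemma mult_D_Cons:
  assumes "y \<in> I"
  shows "y * D (e # w) y = y / (2 * (y - c)) * (1 + (e * g y) * D w (e * g y))"
  unfolding D_Cons[OF assms] by simp

lemma h_bounds:
  "set w \<subseteq> {1, - 1} \<Longrightarrow> y \<in> I \<Longrightarrow>
    - 1 / 4 \<le> 1 + y * D w y \<and> 1 + y * D w y \<le> 5 / 4"
proof (induction w arbitrary: y)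
  case (Cons e w)
  have e: "e = 1 \<or> e = - 1" using Cons by auto
  let ?a = "y / (2 * (y - c))" and ?h = "1 + (e * g y) * D w (e * g y)"
  have h: "- 1 / 4 \<le> ?h" "?h \<le> 5 / 4"
    using Cons.IH[of "e * g y"] Cons.prems sg_in_I[OF _ e] by auto
  note a = coeff_bounds[OF Cons.prems(2)]
  have "- (5 / 4 * 1) \<le> ?a * ?h \<and> ?a * ?h \<le> 1 / 4"
    by (rule coeff_mult_bounds[OF a h]) auto
  then show ?case
    unfolding mult_D_Cons[OF Cons.prems(2)] by linarith
qed simp

text \<open>On \<open>[- sqrt (- c), sqrt (- c)]\<close> the coefficient \<open>a\<close> stays away
  from -1, so one further step of the recursion lifts the lower bound from -1/4 to a positive
  number.\<close>

lemma h_lower: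
  assumes w: "set w \<subseteq> {1, - 1}" and y: "y \<in> I" "\<bar>y\<bar> \<le> sqrt (- c)"
  shows "3 / 10 \<le> 1 + y * D w y"
proof (cases w)
  case (Cons e v)
  have e: "e = 1 \<or> e = - 1" and v: "set v \<subseteq> {1, - 1}" using w Cons by auto
  let ?a = "y / (2 * (y - c))" and ?h = "1 + (e * g y) * D v (e * g y)"
  have h: "- 1 / 4 \<le> ?h" "?h \<le> 5 / 4"
    using h_bounds[OF v sg_in_I[OF y(1) e]] by auto
  define q where "q = sqrt (- c)"
  have q: "q\<^sup>2 = - c" "193 / 100 < q"
    using c real_less_rsqrt[of "193 / 100" "- c"] by (simp_all add: q_def power2_eq_square)
  have "0 < y - c" using I_gt y by auto
  \<comment> \<open>The worst point is \<open>y = - q\<close>, where the coefficient equals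
    \<open>- 1 / (2 * (q - 1))\<close>; this is above -0.54 since \<open>q > 1.93\<close>. Then 1 -
    5/4 * 0.54 = 0.325 exceeds 3/10.\<close>
  have "- (54 / 100) \<le> ?a"
  proof -
    have "193 / 100 * q \<le> q * q" using q by (intro mult_right_mono) auto
    then have "193 / 100 * q \<le> - c" using q(1) by (simp only: power2_eq_square)
    moreover have "- y \<le> q" "0 < q" using y(2) q by (simp_all add: q_def[symmetric])
    ultimately have "0 \<le> y + (54 / 100) * (2 * (y - c))" by argo
    then show ?thesis using \<open>0 < y - c\<close> by (simp add: field_simps)
  qed
  note a = this coeff_bounds[OF y(1)]
  have "- (5 / 4 * (54 / 100)) \<le> ?a * ?h"
    using coeff_mult_bounds[OF a(1,3) h] by simp
  then show ?thesis
    unfolding Cons mult_D_Cons[OF y(1)] by argo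
qed simp

text \<open>The factor \<open>1 / (2 * b)\<close> bounds \<open>1 / (2 * g x)\<close> from below;
  the other is \<open>1 / (2 * - c)\<close> times 1/20, where 1/20 = 3/10 - 1/4.\<close>

definition \<kappa> :: real where "\<kappa> = 1 / (2 * b) * (1 / (40 * (- c)))"

lemma \<kappa>_pos: "0 < \<kappa>"
  unfolding \<kappa>_def using b_pos c by (intro mult_pos_pos divide_pos_pos) auto

text \<open>With \<open>r = g x\<close>, the difference is \<open>1 / (2 * r)\<close> times
  \<open>D w r + D w' (- r)\<close>. At \<open>r\<close> the bound -1/4 is multiplied by less than
  \<open>1 / (2 * - c)\<close>; at \<open>- r\<close> the bound 3/10 is multiplied by more, and it
  applies because \<open>g (- r) < sqrt (- c)\<close>. The words \<open>w\<close> and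
  \<open>w'\<close> must be nonempty: for empty ones the difference is 0.\<close>

lemma frequency_separation:
  assumes x: "x \<in> I" and w: "w \<in> words (Suc n)" and w': "w' \<in> words (Suc n)"
  shows "\<kappa> \<le> D (1 # w) x - D (- 1 # w') x"
proof -
  obtain f u where fu: "w = f # u" "f = 1 \<or> f = - 1" "set u \<subseteq> {1, - 1}"
    using w by (auto dest: set_words)
  obtain f' u' where fu': "w' = f' # u'" "f' = 1 \<or> f' = - 1" "set u' \<subseteq> {1, - 1}"
    using w' by (auto dest: set_words)
  define r where "r = g x"
  have r: "0 < r" "r \<le> b" "r \<in> I" "- r \<in> I"
    using g_gt[OF x] g_in_I[OF x] by (auto simp: r_def)
  have 1: "- 1 / 4 \<le> 1 + (f * g r) * D u (f * g r)"
    using h_bounds[OF fu(3) sg_in_I[OF r(3) fu(2)]] by simp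
  have 2: "3 / 10 \<le> 1 + (f' * g (- r)) * D u' (f' * g (- r))"
  proof (rule h_lower[OF fu'(3) sg_in_I[OF r(4) fu'(2)]])
    have "g (- r) \<le> sqrt (- c)" "0 < g (- r)"
      using r(1) g_gt[OF r(4)] unfolding g_def by (simp, linarith)
    then show "\<bar>f' * g (- r)\<bar> \<le> sqrt (- c)" using fu'(2) by auto
  qed
  have "0 < - r - c" using I_gt[OF r(4)] by simp
  then have p: "1 / (2 * (r - c)) \<le> 1 / (2 * - c)" "1 / (2 * - c) \<le> 1 / (2 * (- r - c))"
    "0 < 1 / (2 * (r - c))" "0 < 1 / (2 * - c)"
    using r c by (intro frac_le divide_pos_pos; simp)+
  have 3: "1 / (2 * (r - c)) * (- 1 / 4) \<le> D w r"
    unfolding fu D_Cons[OF r(3)]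
    by (rule mult_left_mono[OF 1]) (use p in linarith)
  have 4: "1 / (2 * (- r - c)) * (3 / 10) \<le> D w' (- r)"
    unfolding fu' D_Cons[OF r(4)]
    by (rule mult_left_mono[OF 2]) (use p in linarith)
  \<comment> \<open>Both coefficients are compared with their common separator
    \<open>1 / (2 * - c)\<close>, in the role of \<open>K\<close>.\<close>
  have combine: "K * (1 / 20) \<le> d + d'"
    if "A \<le> K" "K \<le> B" "A * (- 1 / 4) \<le> d" "B * (3 / 10) \<le> d'" for A B K d d' :: real
    using that by argo
  have "1 / (40 * (- c)) = 1 / (2 * - c) * (1 / 20)" by simp
  also have "\<dots> \<le> D w r + D w' (- r)" by (rule combine[OF p(1,2) 3 4])
  finally have "1 / (40 * (- c)) \<le> D w r + D w' (- r)" .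
  moreover have "1 / (2 * b) \<le> 1 / (2 * r)" using r by (simp add: frac_le)
  moreover have "D (1 # w) x - D (- 1 # w') x = 1 / (2 * r) * (D w r + D w' (- r))"
    by (simp add: r_def algebra_simps add_divide_distrib)
  ultimately show ?thesis
    unfolding \<kappa>_def using b_pos c r(1) by (simp only:) (intro mult_mono, auto)
qed

end

section \<open>The cross term\<close>

context quadratic_interval
begin

definition C1 :: "(real \<Rightarrow> complex) \<Rightarrow> (real \<Rightarrow> complex) \<Rightarrow> bool" where
  "C1 U U' \<longleftrightarrow> (\<forall>x\<in>I. (U has_vector_derivative U' x) (at x)) \<and> continuous_on I U'"

definition transfer_fixed :: "complex \<Rightarrow> (real \<Rightarrow> complex) \<Rightarrow> bool" where
  "transfer_fixed s U \<longleftrightarrow> (\<forall>x\<in>I. U x = exp (- (s * of_real (L x))) * (U (g x) + U (- g x)))"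

definition sqnorm :: "(real \<Rightarrow> complex) \<Rightarrow> real" where
  "sqnorm F = integral I (\<lambda>x. (norm (F x))\<^sup>2)"

lemma C1_cont: "C1 U U' \<Longrightarrow> continuous_on I U"
  unfolding C1_def
  by (meson has_vector_derivative_continuous continuous_at_imp_continuous_on)

section \<open>Iterates as sums over words\<close>

lemma push_funpow:
  "(push ^^ n) P x = (\<Sum>w\<in>words n. exp (- S w x) * P (G w x))"
proof (induction n arbitrary: x)
  case (Suc n)
  have "exp (- S (e # w) x) = exp (- L x) * exp (- S w (e * g x))" for e w
    by (simp add: exp_add[symmetric])
  then have "(\<Sum>w\<in>words (Suc n). exp (- S w x) * P (G w x)) =
      exp (- L x) * ((\<Sum>w\<in>words n. exp (- S w (g x)) * P (G w (g x))) +
        (\<Sum>w\<in>words n. exp (- S w (- g x)) * P (G w (- g x))))"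
    by (simp add: sum_words_Suc sum_distrib_left distrib_left mult.assoc del: words.simps S.simps)
  then show ?case by (simp add: push_def[of "(push ^^ n) P"] Suc.IH del: words.simps)
qed simp

lemma transfer_fixed_iterate:
  assumes "transfer_fixed s U" "x \<in> I"
  shows "U x = (\<Sum>w\<in>words n. exp (- (s * of_real (S w x))) * U (G w x))"
  using assms(2)
proof (induction n arbitrary: x)
  case (Suc n)
  have "exp (- (s * of_real (S (e # w) x))) = exp (- (s * of_real (L x))) * exp (- (s * of_real (S w (e * g x))))"
    for e w by (simp add: exp_add[symmetric] distrib_left)
  then have "(\<Sum>w\<in>words (Suc n). exp (- (s * of_real (S w x))) * U (G w x)) =
      exp (- (s * of_real (L x))) *
      ((\<Sum>w\<in>words n. exp (- (s * of_real (S w (g x)))) * U (G w (g x))) +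
       (\<Sum>w\<in>words n. exp (- (s * of_real (S w (- g x)))) * U (G w (- g x))))"
    by (simp add: sum_words_Suc sum_distrib_left distrib_left mult.assoc del: words.simps S.simps)
  also have "\<dots> = exp (- (s * of_real (L x))) * (U (g x) + U (- g x))"
    using Suc.IH g_in_I[OF Suc.prems] by simp
  also have "\<dots> = U x" using assms(1) Suc.prems by (simp add: transfer_fixed_def)
  finally show ?case by simp
qed simp

lemma cont_comp_G:
  assumes "continuous_on I F" "set w \<subseteq> {1, - 1}"
  shows "continuous_on I (\<lambda>x. F (G w x))"
  by (rule continuous_on_compose2[OF assms(1) cont_G[OF assms(2)]]) (use G_in_I[OF assms(2)] in blast)

text \<open>The size of one summand of an iterate at the critical value \<open>Re s = 1/2\<close>.
  The squares of the amplitudes of all words of length \<open>n\<close> add up to the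
  \<open>n\<close>-th iterate of \<open>push\<close> at the squared norm of
  \<open>F\<close>.\<close>

definition amp :: "(real \<Rightarrow> complex) \<Rightarrow> real list \<Rightarrow> real \<Rightarrow> real" where
  "amp F w x = exp (- S w x / 2) * norm (F (G w x))"

lemma amp_nonneg: "0 \<le> amp F w x"
  by (simp add: amp_def)

lemma cont_amp: "continuous_on I F \<Longrightarrow> set w \<subseteq> {1, - 1} \<Longrightarrow> continuous_on I (amp F w)"
  unfolding amp_def[abs_def] by (intro continuous_intros cont_S cont_comp_G) auto

lemma sqnorm_nonneg: "0 \<le> sqnorm F"
proof (cases "(\<lambda>x. (norm (F x))\<^sup>2) integrable_on I")
  case True
  then show ?thesis unfolding sqnorm_def by (intro integral_nonneg) auto
\<comment> \<open>The integral of a function that is not integrable is 0 by convention.\<close>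
qed (simp add: sqnorm_def not_integrable_integral)

lemma cont_push_funpow:
  "continuous_on I P \<Longrightarrow> continuous_on I ((push ^^ n) P)"
  by (induction n) (auto intro: cont_push)

lemma integral_push_funpow_le:
  assumes "continuous_on I P" "\<And>y. y \<in> I \<Longrightarrow> 0 \<le> P y"
  shows "integral I ((push ^^ n) P) \<le> integral I P"
proof (induction n)
  case (Suc n)
  have "0 \<le> (push ^^ n) P y" if "y \<in> I" for y
    using that by (induction n arbitrary: y) (auto intro: assms push_nonneg)
  then have "integral I (push ((push ^^ n) P)) \<le> integral I ((push ^^ n) P)"
    by (intro integral_push_le cont_push_funpow assms)
  with Suc show ?case by simp
qed simp

text \<open>Cauchy-Schwarz over the \<open>2 ^ n\<close> words, followed by the fact that
  \<open>push\<close> does not increase integrals of nonnegative functions.\<close>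

lemma integral_amp_square_le:
  assumes F: "continuous_on I F"
  shows "integral I (\<lambda>x. (\<Sum>w\<in>words n. amp F w x)\<^sup>2) \<le> 2 ^ n * sqnorm F"
proof -
  let ?P = "\<lambda>x. (norm (F x))\<^sup>2"
  have P: "continuous_on I ?P" by (intro continuous_intros F)
  have "integral I (\<lambda>x. (\<Sum>w\<in>words n. amp F w x)\<^sup>2) \<le> integral I (\<lambda>x. 2 ^ n * (push ^^ n) ?P x)"
  proof (rule integral_le)
    show "(\<lambda>x. (\<Sum>w\<in>words n. amp F w x)\<^sup>2) integrable_on I"
      by (intro integrable_continuous_interval continuous_intros cont_amp F set_words)
    show "(\<lambda>x. 2 ^ n * (push ^^ n) ?P x) integrable_on I"
      by (intro integrable_continuous_interval continuous_intros cont_push_funpow P)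
    fix x assume "x \<in> I"
    have "(exp (- S w x / 2))\<^sup>2 = exp (- S w x)" for w
      by (simp add: power2_eq_square exp_add[symmetric])
    then have "(\<Sum>w\<in>words n. (amp F w x)\<^sup>2) = (push ^^ n) ?P x"
      by (simp add: push_funpow amp_def power_mult_distrib)
    then show "(\<Sum>w\<in>words n. amp F w x)\<^sup>2 \<le> 2 ^ n * (push ^^ n) ?P x"
      using sum_squared_le_sum_of_squares[of "\<lambda>w. amp F w x" "words n"]
      by (simp add: card_words mult.commute)
  qed
  also have "\<dots> = 2 ^ n * integral I ((push ^^ n) ?P)"
    by simp
  also have "\<dots> \<le> 2 ^ n * sqnorm F"
    unfolding sqnorm_def by (intro mult_left_mono integral_push_funpow_le P) auto
  finally show ?thesis .
qed

lemma bounded_on_I: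
  fixes f :: "real \<Rightarrow> real"
  assumes "continuous_on I f"
  shows "\<exists>K\<ge>0. \<forall>x\<in>I. \<bar>f x\<bar> \<le> K"
proof -
  have "bounded (f ` I)"
    by (intro compact_imp_bounded compact_continuous_image assms compact_Icc)
  then obtain K where "\<And>x. x \<in> I \<Longrightarrow> \<bar>f x\<bar> \<le> K"
    unfolding bounded_iff real_norm_def by blast
  then show ?thesis by (intro exI[of _ "max 0 K"]) (meson max.cobounded1 max.coboundedI2)
qed

section \<open>Oscillation of a single pair of words\<close>

lemma has_vector_derivative_comp_G:
  assumes "C1 U U'" "set w \<subseteq> {1, - 1}" "x \<in> I"
  shows "((\<lambda>x. U (G w x)) has_vector_derivative of_real (G' w x) * U' (G w x)) (at x)"
proof -
  have 1: "(G w has_vector_derivative G' w x) (at x)"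
    using DERIV_G[OF assms(2,3)] by (simp add: has_real_derivative_iff_has_vector_derivative)
  have 2: "(U has_vector_derivative U' (G w x)) (at (G w x))"
    using assms G_in_I by (auto simp: C1_def)
  show ?thesis using vector_diff_chain_at[OF 1 2] by (simp add: o_def scaleR_conv_of_real)
qed

text \<open>The phase is \<open>Im s\<close> times the difference of the two \<open>S\<close>, whose
  derivative is at least \<open>\<kappa>\<close>. Where the derivative falls on \<open>U\<close>,
  the chain rule yields a factor \<open>G'\<close>, hence the contraction
  \<open>(5 / 11) ^ (n + 2)\<close>. Everything else goes into \<open>C\<close>, which is
  independent of \<open>U\<close> and \<open>s\<close>.\<close>

lemma pair_oscillation:
  assumes w: "w \<in> words (Suc n)" and w': "w' \<in> words (Suc n)"
    and \<eta>: "\<And>x. (\<eta> has_real_derivative \<eta>' x) (at x)" "continuous_on UNIV \<eta>'"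
      "\<And>x. \<bar>x\<bar> \<le> b \<Longrightarrow> 0 \<le> \<eta> x \<and> \<eta> x \<le> 1" "\<eta> b = 0" "\<eta> (- b) = 0"
  shows "\<exists>C\<ge>0. \<forall>U U' s. C1 U U' \<longrightarrow> 1 / 2 \<le> Re s \<longrightarrow> Re s \<le> 1 \<longrightarrow>
    \<bar>Im s\<bar> * norm (integral I (\<lambda>x. of_real (\<eta> x) *
      ((exp (- (s * of_real (S (1 # w) x))) * U (G (1 # w) x)) *
       cnj (exp (- (s * of_real (S (- 1 # w') x))) * U (G (- 1 # w') x)))))
    \<le> integral I (\<lambda>x. C * (amp U (1 # w) x * amp U (- 1 # w') x) +
        (5 / 11) ^ (n + 2) / \<kappa> * (amp U' (1 # w) x * amp U (- 1 # w') x +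
          amp U (1 # w) x * amp U' (- 1 # w') x))"
proof -
  define v v' where "v = 1 # w" and "v' = - 1 # w'"
  have v: "set v \<subseteq> {1, - 1}" "set v' \<subseteq> {1, - 1}" "length v = n + 2" "length v' = n + 2"
    using w w' set_words[OF w] set_words[OF w'] length_words[OF w] length_words[OF w']
    by (simp_all add: v_def v'_def)
  obtain D2 where D2: "\<And>x. x \<in> I \<Longrightarrow> (D v has_real_derivative D2 x) (at x)" "continuous_on I D2"
    using D_C1[OF v(1)] by blast
  obtain D2' where D2': "\<And>x. x \<in> I \<Longrightarrow> (D v' has_real_derivative D2' x) (at x)" "continuous_on I D2'"
    using D_C1[OF v(2)] by blast
  obtain K where K: "0 \<le> K" "\<And>x. x \<in> I \<Longrightarrow> \<bar>D2 x - D2' x\<bar> \<le> K"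
    using bounded_on_I[OF continuous_on_diff[OF D2(2) D2'(2)]] by blast
  obtain K1 where K1: "0 \<le> K1" "\<And>x. x \<in> I \<Longrightarrow> \<bar>\<eta>' x\<bar> \<le> K1"
    using bounded_on_I[OF continuous_on_subset[OF \<eta>(2) subset_UNIV]] by blast
  obtain K2 where K2: "0 \<le> K2" "\<And>x. x \<in> I \<Longrightarrow> \<bar>D v x + D v' x\<bar> \<le> K2"
    using bounded_on_I[OF continuous_on_add[OF cont_D[OF v(1)] cont_D[OF v(2)]]] by blast
  \<comment> \<open>\<open>K1\<close> comes from differentiating the cutoff, \<open>K2\<close> from
    differentiating the weights, and \<open>K\<close> from the second derivative of the
    phase.\<close>
  define C where "C = (K1 + K2) / \<kappa> + K / \<kappa>\<^sup>2"
  have C0: "0 \<le> C" using K K1 K2 \<kappa>_pos by (simp add: C_def)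
  have c\<eta>: "continuous_on I \<eta>"
    using \<eta>(1) by (meson DERIV_isCont continuous_at_imp_continuous_on)
  show ?thesis
  proof (intro exI[of _ C] conjI C0 allI impI)
    fix U U' s assume U: "C1 U U'" and s: "1 / 2 \<le> Re s" "Re s \<le> 1"
    define t where "t = Im s"
    define A where "A = (\<lambda>x. \<eta> x * exp (- (Re s * (S v x + S v' x))))"
    define A' where "A' = (\<lambda>x. (\<eta>' x - \<eta> x * (Re s * (D v x + D v' x))) *
      exp (- (Re s * (S v x + S v' x))))"
    define P where "P = (\<lambda>x. U (G v x) * cnj (U (G v' x)))"
    define P' where "P' = (\<lambda>x. U (G v x) * cnj (of_real (G' v' x) * U' (G v' x)) +
      of_real (G' v x) * U' (G v x) * cnj (U (G v' x)))"
    define F where "F = (\<lambda>x. of_real (A x) * P x)"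
    define F' where "F' = (\<lambda>x. of_real (A x) * P' x + of_real (A' x) * P x)"
    have cU: "continuous_on I U" "continuous_on I U'" using U C1_cont by (auto simp: C1_def)
    have dF: "(F has_vector_derivative F' x) (at x)" if x: "x \<in> I" for x
    proof -
      have "(A has_real_derivative A' x) (at x)"
        unfolding A_def A'_def
        by (rule DERIV_cong, rule DERIV_mult[OF \<eta>(1) DERIV_chain2[OF DERIV_exp
          DERIV_minus[OF DERIV_cmult[OF DERIV_add[OF DERIV_S[OF v(1) x] DERIV_S[OF v(2) x]]]]]])
          (simp add: algebra_simps)
      then have 1: "((\<lambda>x. complex_of_real (A x)) has_vector_derivative of_real (A' x)) (at x)"
        by (intro has_vector_derivative_of_real)
      have 2: "(P has_vector_derivative P' x) (at x)"
        unfolding P_def P'_def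
        by (intro has_vector_derivative_mult has_vector_derivative_cnj
            has_vector_derivative_comp_G[OF U] v x)
      show ?thesis unfolding F_def F'_def by (rule has_vector_derivative_mult[OF 1 2])
    qed
    have cF': "continuous_on I F'"
      unfolding F'_def A_def A'_def P_def P'_def
      by (intro continuous_intros c\<eta> cont_S cont_D cont_G' cont_comp_G cU v
          continuous_on_subset[OF \<eta>(2)]) auto
    have d\<psi>: "((\<lambda>x. S v x - S v' x) has_real_derivative D v x - D v' x) (at x)" if "x \<in> I" for x
      by (intro DERIV_diff DERIV_S v that)
    have d\<psi>': "((\<lambda>x. D v x - D v' x) has_real_derivative D2 x - D2' x) (at x)" if "x \<in> I" for x
      by (intro DERIV_diff D2(1) D2'(1) that)
    have "\<bar>t\<bar> * norm (integral I (\<lambda>x. F x * exp (- (\<i> * of_real (t * (S v x - S v' x))))))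
      \<le> integral I (\<lambda>x. norm (F' x) / \<kappa> + K * norm (F x) / \<kappa>\<^sup>2)"
      by (rule nonstationary_phase[OF _ \<kappa>_pos dF d\<psi> d\<psi>' cF' _ _ K(2)])
        (use frequency_separation[OF _ w w'] b_pos in
          \<open>auto simp: v_def v'_def F_def A_def \<eta>(4,5) intro!: continuous_intros D2(2) D2'(2)\<close>)
    also have "\<dots> \<le> integral I (\<lambda>x. C * (amp U v x * amp U v' x) +
        (5 / 11) ^ (n + 2) / \<kappa> * (amp U' v x * amp U v' x + amp U v x * amp U' v' x))"
    proof (rule integral_le)
      have "continuous_on I F"
        using dF by (meson has_vector_derivative_continuous continuous_at_imp_continuous_on)
      then show "(\<lambda>x. norm (F' x) / \<kappa> + K * norm (F x) / \<kappa>\<^sup>2) integrable_on I"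
        using \<kappa>_pos by (intro integrable_continuous_interval continuous_intros cF') auto
      show "(\<lambda>x. C * (amp U v x * amp U v' x) +
        (5 / 11) ^ (n + 2) / \<kappa> * (amp U' v x * amp U v' x + amp U v x * amp U' v' x)) integrable_on I"
        by (intro integrable_continuous_interval continuous_intros cont_amp cU v)
      fix x assume x: "x \<in> I"
      define E where "E = exp (- S v x / 2) * exp (- S v' x / 2)"
      define q :: real where "q = (5 / 11) ^ (n + 2)"
      define R where "R = norm (U' (G v x)) * norm (U (G v' x)) + norm (U (G v x)) * norm (U' (G v' x))"
      have B: "0 \<le> S v x + S v' x" using S_nonneg v x by simp
      \<comment> \<open>Since \<open>S\<close> is nonnegative, raising \<open>Re s\<close> above 1/2
        only decreases the weight.\<close>
      have e1: "exp (- (Re s * (S v x + S v' x))) \<le> E"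
        using mult_right_mono[OF s(1) B] by (simp add: E_def exp_add[symmetric])
      have \<eta>x: "0 \<le> \<eta> x" "\<eta> x \<le> 1" using \<eta>(3)[of x] x by auto
      have A: "\<bar>A x\<bar> \<le> E"
        using mult_mono[OF \<eta>x(2) e1] \<eta>x by (simp add: A_def abs_mult)
      have "\<bar>\<eta> x * (Re s * (D v x + D v' x))\<bar> \<le> 1 * (1 * K2)"
        unfolding abs_mult using \<eta>x s K2(1) K2(2)[OF x] by (intro mult_mono) auto
      then have "\<bar>\<eta>' x - \<eta> x * (Re s * (D v x + D v' x))\<bar> \<le> K1 + K2"
        using K1(2)[OF x] by linarith
      then have A': "\<bar>A' x\<bar> \<le> (K1 + K2) * E"
        unfolding A'_def abs_mult using e1 K1 K2 by (intro mult_mono) auto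
      have G1: "\<bar>G' v x\<bar> \<le> q" "\<bar>G' v' x\<bar> \<le> q"
        using abs_G' exp_S_le[OF v(1) x] exp_S_le[OF v(2) x] v x by (simp_all add: q_def)
      have "norm (P' x) \<le> norm (U (G v x)) * (\<bar>G' v' x\<bar> * norm (U' (G v' x))) +
          \<bar>G' v x\<bar> * norm (U' (G v x)) * norm (U (G v' x))"
        unfolding P'_def
        by (rule order_trans[OF norm_triangle_ineq]) (simp add: norm_mult)
      also have "\<dots> \<le> norm (U (G v x)) * (q * norm (U' (G v' x))) +
          q * norm (U' (G v x)) * norm (U (G v' x))"
        using G1 by (intro add_mono mult_left_mono mult_right_mono) auto
      also have "\<dots> = q * R" by (simp add: R_def algebra_simps)
      finally have P': "norm (P' x) \<le> q * R" .
      have nF: "norm (F x) \<le> E * norm (P x)"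
        unfolding F_def norm_mult norm_of_real by (intro mult_right_mono A) auto
      have "norm (F' x) \<le> \<bar>A x\<bar> * norm (P' x) + \<bar>A' x\<bar> * norm (P x)"
        unfolding F'_def
        by (rule order_trans[OF norm_triangle_ineq]) (simp add: norm_mult)
      also have "\<dots> \<le> E * (q * R) + (K1 + K2) * E * norm (P x)"
        using A A' P' by (intro add_mono mult_mono) (auto simp: E_def)
      finally have "norm (F' x) / \<kappa> + K * norm (F x) / \<kappa>\<^sup>2 \<le>
          (E * (q * R) + (K1 + K2) * E * norm (P x)) / \<kappa> + K * (E * norm (P x)) / \<kappa>\<^sup>2"
        using nF K(1) \<kappa>_pos by (intro add_mono divide_right_mono mult_left_mono) auto
      also have "\<dots> = C * (E * norm (P x)) + q / \<kappa> * (E * R)"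
        by (simp add: C_def algebra_simps add_divide_distrib)
      also have "E * norm (P x) = amp U v x * amp U v' x"
        by (simp add: E_def P_def amp_def norm_mult)
      also have "E * R = amp U' v x * amp U v' x + amp U v x * amp U' v' x"
        by (simp add: E_def R_def amp_def algebra_simps)
      finally show "norm (F' x) / \<kappa> + K * norm (F x) / \<kappa>\<^sup>2 \<le> C * (amp U v x * amp U v' x) +
        (5 / 11) ^ (n + 2) / \<kappa> * (amp U' v x * amp U v' x + amp U v x * amp U' v' x)"
        by (simp only: q_def)
    qed
    \<comment> \<open>The product of one weight with the conjugate of the other splits into the
      modulus, kept in \<open>A\<close>, and the phase.\<close>
    also have "(\<lambda>x. F x * exp (- (\<i> * of_real (t * (S v x - S v' x))))) =
      (\<lambda>x. of_real (\<eta> x) * ((exp (- (s * of_real (S v x))) * U (G v x)) *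
       cnj (exp (- (s * of_real (S v' x))) * U (G v' x))))"
    proof
      fix x
      have "exp (- (s * of_real (S v x))) * cnj (exp (- (s * of_real (S v' x)))) =
        of_real (exp (- (Re s * (S v x + S v' x)))) * exp (- (\<i> * of_real (t * (S v x - S v' x))))"
        unfolding exp_cnj exp_of_real[symmetric] exp_add[symmetric]
        by (rule arg_cong[of _ _ exp]) (simp add: complex_eq_iff t_def algebra_simps)
      then show "F x * exp (- (\<i> * of_real (t * (S v x - S v' x)))) =
        of_real (\<eta> x) * ((exp (- (s * of_real (S v x))) * U (G v x)) *
          cnj (exp (- (s * of_real (S v' x))) * U (G v' x)))"
        by (simp add: F_def A_def P_def mult_ac)
    qed
    finally show "\<bar>Im s\<bar> * norm (integral I (\<lambda>x. of_real (\<eta> x) *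
      ((exp (- (s * of_real (S (1 # w) x))) * U (G (1 # w) x)) *
       cnj (exp (- (s * of_real (S (- 1 # w') x))) * U (G (- 1 # w') x)))))
    \<le> integral I (\<lambda>x. C * (amp U (1 # w) x * amp U (- 1 # w') x) +
        (5 / 11) ^ (n + 2) / \<kappa> * (amp U' (1 # w) x * amp U (- 1 # w') x +
          amp U (1 # w) x * amp U' (- 1 # w') x))"
      by (simp only: t_def v_def v'_def)
  qed
qed

text \<open>Both factors are expanded over words and the pair estimates are summed. The order of
  choices is decisive: first \<open>n\<close>, so that the contraction beats the number of words and
  \<open>\<kappa>\<close>, then \<open>T\<close>, which absorbs the constants of the finitely many
  pairs.\<close>

lemma cross_term_le:
  assumes \<eta>: "\<And>x. (\<eta> has_real_derivative \<eta>' x) (at x)" "continuous_on UNIV \<eta>'"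
      "\<And>x. \<bar>x\<bar> \<le> b \<Longrightarrow> 0 \<le> \<eta> x \<and> \<eta> x \<le> 1" "\<eta> b = 0" "\<eta> (- b) = 0"
    and \<delta>: "0 < \<delta>"
  shows "\<exists>T\<ge>1. \<forall>U U' s. C1 U U' \<longrightarrow> transfer_fixed s U \<longrightarrow> 1 / 2 \<le> Re s \<longrightarrow> Re s \<le> 1 \<longrightarrow>
    T < \<bar>Im s\<bar> \<longrightarrow> sqnorm U' \<le> 12 * (Im s)\<^sup>2 * sqnorm U \<longrightarrow>
    norm (integral I (\<lambda>x. of_real (\<eta> x) * ((exp (- (s * of_real (L x))) * U (g x)) *
      cnj (exp (- (s * of_real (L x))) * U (- g x))))) \<le> \<delta> * sqnorm U"
proof -
  have "(\<lambda>n. (10 / 11 :: real) ^ n) \<longlonglongrightarrow> 0" by (intro LIMSEQ_realpow_zero) auto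
  then have "\<forall>\<^sub>F n in sequentially. (10 / 11 :: real) ^ n < \<delta> * \<kappa> / 26"
    using \<delta> \<kappa>_pos by (intro order_tendstoD(2)) auto
  then obtain n where n: "(10 / 11 :: real) ^ n < \<delta> * \<kappa> / 26"
    unfolding eventually_sequentially by blast
  \<comment> \<open>One letter selects the branch, and the remaining \<open>Suc n\<close> form the
    nonempty word that the separation of frequencies requires.\<close>
  define N where "N = n + 2"
  define q :: real where "q = (5 / 11) ^ N"
  let ?W = "words (Suc n)"
  have N: "2 ^ N * q * 13 / \<kappa> \<le> \<delta> / 2"
  proof -
    have "2 ^ N * q = (10 / 11 :: real) ^ N" by (simp add: q_def power_mult_distrib[symmetric])
    also have "\<dots> \<le> (10 / 11 :: real) ^ n" unfolding N_def by (intro power_decreasing) auto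
    also have "\<dots> \<le> \<delta> * \<kappa> / 26" using n by simp
    finally show ?thesis using \<kappa>_pos by (simp add: field_simps)
  qed
  let ?pair = "\<lambda>U s w w' x. (exp (- (s * of_real (S (1 # w) x))) * U (G (1 # w) x)) *
       cnj (exp (- (s * of_real (S (- 1 # w') x))) * U (G (- 1 # w') x))"
  let ?mix = "\<lambda>U U' w w' x. amp U' (1 # w) x * amp U (- 1 # w') x +
          amp U (1 # w) x * amp U' (- 1 # w') x"
  define good where "good k w w' \<longleftrightarrow> 0 \<le> k \<and>
    (\<forall>U U' s. C1 U U' \<longrightarrow> 1 / 2 \<le> Re s \<longrightarrow> Re s \<le> 1 \<longrightarrow>
      \<bar>Im s\<bar> * norm (integral I (\<lambda>x. of_real (\<eta> x) * ?pair U s w w' x))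
      \<le> integral I (\<lambda>x. k * (amp U (1 # w) x * amp U (- 1 # w') x) +
        q / \<kappa> * ?mix U U' w w' x))" for k w w'
  define C where "C w w' = (SOME k. good k w w')" for w w'
  have good: "good (C w w') w w'" if "w \<in> ?W" "w' \<in> ?W" for w w'
    unfolding C_def good_def q_def N_def by (rule someI_ex[OF pair_oscillation[OF that \<eta>]])
  then have C0: "0 \<le> C w w'" if "w \<in> ?W" "w' \<in> ?W" for w w'
    using that by (simp only: good_def)
  define K where "K = (\<Sum>w\<in>?W. \<Sum>w'\<in>?W. C w w')"
  have CK: "C w w' \<le> K" if "w \<in> ?W" "w' \<in> ?W" for w w'
  proof -
    have "C w w' \<le> (\<Sum>w'\<in>?W. C w w')"
      using C0 that by (intro member_le_sum finite_words) auto
    also have "\<dots> \<le> K" unfolding K_def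
      using C0 that by (intro member_le_sum[of _ _ "\<lambda>w. \<Sum>w'\<in>?W. C w w'"] finite_words sum_nonneg) auto
    finally show ?thesis .
  qed
  have K0: "0 \<le> K" unfolding K_def using C0 by (intro sum_nonneg)
  \<comment> \<open>Beyond \<open>T\<close> the term \<open>2 ^ N * K\<close> is at most
    \<open>\<delta> / 2\<close> times \<open>\<bar>Im s\<bar>\<close>. The 1 serves to compare
    \<open>norm s\<close> with \<open>Im s\<close> later.\<close>
  define T where "T = max 1 (2 * (2 ^ N * K) / \<delta>)"
  show ?thesis
  proof (intro exI[of _ T] conjI allI impI)
    show "1 \<le> T" by (simp add: T_def)
    fix U U' s assume U: "C1 U U'" and fixed: "transfer_fixed s U" and s: "1 / 2 \<le> Re s" "Re s \<le> 1"
      and T: "T < \<bar>Im s\<bar>" and dU: "sqnorm U' \<le> 12 * (Im s)\<^sup>2 * sqnorm U"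
    define t where "t = \<bar>Im s\<bar>"
    have t: "0 < t" "2 * (2 ^ N * K) / \<delta> < t" using T by (auto simp: T_def t_def)
    have cU: "continuous_on I U" "continuous_on I U'" using U C1_cont by (auto simp: C1_def)
    have c\<eta>: "continuous_on I \<eta>"
      using \<eta>(1) by (meson DERIV_isCont continuous_at_imp_continuous_on)
    have W: "set (1 # w) \<subseteq> {1, - 1}" "set (- 1 # w) \<subseteq> {1, - 1}" if "w \<in> ?W" for w
      using set_words[OF that] by auto
    define X where "X = (\<lambda>x. of_real (\<eta> x) * ((exp (- (s * of_real (L x))) * U (g x)) *
      cnj (exp (- (s * of_real (L x))) * U (- g x))))"
    have expand: "exp (- (s * of_real (L x))) * U (e * g x) =
      (\<Sum>w\<in>?W. exp (- (s * of_real (S (e # w) x))) * U (G (e # w) x))"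
      if "x \<in> I" "e = 1 \<or> e = - 1" for x e
    proof -
      have "exp (- (s * of_real (S (e # w) x))) =
        exp (- (s * of_real (L x))) * exp (- (s * of_real (S w (e * g x))))" for w
        by (simp add: exp_add[symmetric] distrib_left)
      then show ?thesis
        using transfer_fixed_iterate[OF fixed sg_in_I[OF that], of "Suc n"]
        by (simp add: sum_distrib_left mult.assoc del: words.simps S.simps)
    qed
    have X: "X x = (\<Sum>w\<in>?W. \<Sum>w'\<in>?W. of_real (\<eta> x) * ?pair U s w w' x)" if "x \<in> I" for x
    proof -
      have 1: "exp (- (s * of_real (L x))) * U (g x) =
          (\<Sum>w\<in>?W. exp (- (s * of_real (S (1 # w) x))) * U (G (1 # w) x))"
        using expand[OF that, of 1] by simp
      have 2: "exp (- (s * of_real (L x))) * U (- g x) =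
          (\<Sum>w\<in>?W. exp (- (s * of_real (S (- 1 # w) x))) * U (G (- 1 # w) x))"
        using expand[OF that, of "- 1"] by simp
      show ?thesis unfolding X_def 1 2 cnj_sum sum_product by (simp only: sum_distrib_left)
    qed
    have cpair: "continuous_on I (\<lambda>x. of_real (\<eta> x) * ?pair U s w w' x)"
      if "w \<in> ?W" "w' \<in> ?W" for w w'
      by (intro continuous_intros c\<eta> cont_S cont_comp_G cU W that)
    have "integral I X = integral I (\<lambda>x. \<Sum>w\<in>?W. \<Sum>w'\<in>?W. of_real (\<eta> x) * ?pair U s w w' x)"
      by (intro integral_cong X)
    also have "\<dots> = (\<Sum>w\<in>?W. \<Sum>w'\<in>?W. integral I (\<lambda>x. of_real (\<eta> x) * ?pair U s w w' x))"
      by (rule integral_double_sum[OF finite_words finite_words cpair])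
    finally have "t * norm (integral I X) \<le>
        t * (\<Sum>w\<in>?W. \<Sum>w'\<in>?W. norm (integral I (\<lambda>x. of_real (\<eta> x) * ?pair U s w w' x)))"
      using t by (auto intro!: mult_left_mono sum_norm_le)
    also have "\<dots> = (\<Sum>w\<in>?W. \<Sum>w'\<in>?W. t * norm (integral I (\<lambda>x. of_real (\<eta> x) * ?pair U s w w' x)))"
      by (simp add: sum_distrib_left del: words.simps)
    also have "\<dots> \<le> (\<Sum>w\<in>?W. \<Sum>w'\<in>?W. integral I (\<lambda>x.
        K * (amp U (1 # w) x * amp U (- 1 # w') x) + q / \<kappa> * ?mix U U' w w' x))"
    proof (intro sum_mono)
      fix w w' assume w: "w \<in> ?W" "w' \<in> ?W"
      have "t * norm (integral I (\<lambda>x. of_real (\<eta> x) * ?pair U s w w' x))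
        \<le> integral I (\<lambda>x. C w w' * (amp U (1 # w) x * amp U (- 1 # w') x) + q / \<kappa> * ?mix U U' w w' x)"
        using good[OF w] U s unfolding t_def good_def by blast
      also have "\<dots> \<le> integral I (\<lambda>x.
        K * (amp U (1 # w) x * amp U (- 1 # w') x) + q / \<kappa> * ?mix U U' w w' x)"
      proof (rule integral_le)
        have int: "(\<lambda>x. k * (amp U (1 # w) x * amp U (- 1 # w') x) + q / \<kappa> * ?mix U U' w w' x) integrable_on I"
          for k
          by (intro integrable_continuous_interval continuous_intros cont_amp cU W w)
        show "(\<lambda>x. C w w' * (amp U (1 # w) x * amp U (- 1 # w') x) + q / \<kappa> * ?mix U U' w w' x) integrable_on I"
          "(\<lambda>x. K * (amp U (1 # w) x * amp U (- 1 # w') x) + q / \<kappa> * ?mix U U' w w' x) integrable_on I"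
          by (rule int)+
        show "C w w' * (amp U (1 # w) x * amp U (- 1 # w') x) + q / \<kappa> * ?mix U U' w w' x
          \<le> K * (amp U (1 # w) x * amp U (- 1 # w') x) + q / \<kappa> * ?mix U U' w w' x" for x
          using CK[OF w] by (intro add_right_mono mult_right_mono mult_nonneg_nonneg amp_nonneg)
      qed
      finally show "t * norm (integral I (\<lambda>x. of_real (\<eta> x) * ?pair U s w w' x)) \<le> integral I (\<lambda>x.
        K * (amp U (1 # w) x * amp U (- 1 # w') x) + q / \<kappa> * ?mix U U' w w' x)" .
    qed
    also have "\<dots> = integral I (\<lambda>x. \<Sum>w\<in>?W. \<Sum>w'\<in>?W.
        K * (amp U (1 # w) x * amp U (- 1 # w') x) + q / \<kappa> * ?mix U U' w w' x)"
      by (rule integral_double_sum[symmetric, OF finite_words finite_words])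
        (intro continuous_intros cont_amp cU W)
    also have "\<dots> \<le> integral I (\<lambda>x. (K + q / \<kappa> * t) * (\<Sum>w\<in>words N. amp U w x)\<^sup>2 +
        q / \<kappa> / t * (\<Sum>w\<in>words N. amp U' w x)\<^sup>2)"
    proof (rule integral_le)
      show "(\<lambda>x. \<Sum>w\<in>?W. \<Sum>w'\<in>?W. K * (amp U (1 # w) x * amp U (- 1 # w') x) +
          q / \<kappa> * ?mix U U' w w' x) integrable_on I"
        by (intro integrable_continuous_interval continuous_intros cont_amp cU W)
      show "(\<lambda>x. (K + q / \<kappa> * t) * (\<Sum>w\<in>words N. amp U w x)\<^sup>2 +
        q / \<kappa> / t * (\<Sum>w\<in>words N. amp U' w x)\<^sup>2) integrable_on I"
        by (intro integrable_continuous_interval continuous_intros cont_amp cU set_words)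
      fix x
      define a1 a2 where "a1 = (\<Sum>w\<in>?W. amp U (1 # w) x)" and "a2 = (\<Sum>w\<in>?W. amp U (- 1 # w) x)"
      define d1 d2 where "d1 = (\<Sum>w\<in>?W. amp U' (1 # w) x)" and "d2 = (\<Sum>w\<in>?W. amp U' (- 1 # w) x)"
      define a d where "a = (\<Sum>w\<in>words N. amp U w x)" and "d = (\<Sum>w\<in>words N. amp U' w x)"
      have ad: "a = a1 + a2" "d = d1 + d2"
        using sum_words_Suc[of _ "Suc n"] by (simp_all add: a_def d_def a1_def a2_def d1_def d2_def N_def)
      have nn: "0 \<le> a1" "0 \<le> a2" "0 \<le> d1" "0 \<le> d2"
        by (auto simp: a1_def a2_def d1_def d2_def intro!: sum_nonneg amp_nonneg)
      have "0 < q" by (simp add: q_def)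
      have "(\<Sum>w\<in>?W. \<Sum>w'\<in>?W. K * (amp U (1 # w) x * amp U (- 1 # w') x) + q / \<kappa> * ?mix U U' w w' x) =
        K * (a1 * a2) + q / \<kappa> * (d1 * a2 + a1 * d2)"
        unfolding a1_def a2_def d1_def d2_def sum_product
        by (simp only: sum.distrib sum_distrib_left distrib_left)
      also have "\<dots> \<le> K * a\<^sup>2 + q / \<kappa> * (t * a\<^sup>2 + d\<^sup>2 / t)"
      proof (rule add_mono)
        have "a1 * a2 \<le> a\<^sup>2" using nn by (simp add: ad power2_eq_square algebra_simps)
        then show "K * (a1 * a2) \<le> K * a\<^sup>2" using K0 by (rule mult_left_mono)
        \<comment> \<open>The weighted inequality
          \<open>2 * a * d \<le> t * a ^ 2 + d ^ 2 / t\<close> balances the two norms, as the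
          derivative is of size \<open>t\<close>.\<close>
        have "0 \<le> (t * a - d)\<^sup>2" by simp
        then have "2 * (t * (a * d)) \<le> t * (t * a\<^sup>2) + d\<^sup>2" by (simp add: power2_eq_square algebra_simps)
        then have "2 * (a * d) \<le> t * a\<^sup>2 + d\<^sup>2 / t" using t by (simp add: field_simps power2_eq_square)
        moreover have "d1 * a2 + a1 * d2 \<le> a * d" "0 \<le> a * d" using nn by (simp_all add: ad algebra_simps)
        ultimately have "d1 * a2 + a1 * d2 \<le> t * a\<^sup>2 + d\<^sup>2 / t" by linarith
        then show "q / \<kappa> * (d1 * a2 + a1 * d2) \<le> q / \<kappa> * (t * a\<^sup>2 + d\<^sup>2 / t)"
          using \<open>0 < q\<close> \<kappa>_pos by (intro mult_left_mono) auto
      qed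
      also have "\<dots> = (K + q / \<kappa> * t) * a\<^sup>2 + q / \<kappa> / t * d\<^sup>2"
        by (simp add: algebra_simps)
      finally show "(\<Sum>w\<in>?W. \<Sum>w'\<in>?W. K * (amp U (1 # w) x * amp U (- 1 # w') x) +
          q / \<kappa> * ?mix U U' w w' x) \<le> (K + q / \<kappa> * t) * (\<Sum>w\<in>words N. amp U w x)\<^sup>2 +
        q / \<kappa> / t * (\<Sum>w\<in>words N. amp U' w x)\<^sup>2"
        by (simp only: a_def d_def)
    qed
    also have "\<dots> = (K + q / \<kappa> * t) * integral I (\<lambda>x. (\<Sum>w\<in>words N. amp U w x)\<^sup>2) +
        q / \<kappa> / t * integral I (\<lambda>x. (\<Sum>w\<in>words N. amp U' w x)\<^sup>2)"
    proof -
      have "(\<lambda>x. k * (\<Sum>w\<in>words N. amp V w x)\<^sup>2) integrable_on I" if "continuous_on I V" for k V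
        by (intro integrable_continuous_interval continuous_intros cont_amp that set_words)
      then show ?thesis by (simp only: integral_add cU integral_mult_right)
    qed
    also have "\<dots> \<le> (K + q / \<kappa> * t) * (2 ^ N * sqnorm U) + q / \<kappa> / t * (2 ^ N * sqnorm U')"
      using K0 t \<kappa>_pos
      by (intro add_mono mult_left_mono integral_amp_square_le cU) (auto simp: q_def)
    also have "\<dots> \<le> (K + q / \<kappa> * t) * (2 ^ N * sqnorm U) + q / \<kappa> / t * (2 ^ N * (12 * t\<^sup>2 * sqnorm U))"
      using dU t \<kappa>_pos by (intro add_left_mono mult_left_mono) (auto simp: q_def t_def)
    \<comment> \<open>13 = 1 + 12: the square of \<open>U\<close> contributes 1, and the derivative
      bound contributes 12. The choice of \<open>n\<close> with denominator 26 makes this half of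
      \<open>\<delta>\<close>.\<close>
    also have "\<dots> = 2 ^ N * K * sqnorm U + t * ((2 ^ N * q * 13 / \<kappa>) * sqnorm U)"
      using t by (simp add: algebra_simps power2_eq_square add_divide_distrib)
    also have "\<dots> \<le> (t * (\<delta> / 2)) * sqnorm U + t * ((\<delta> / 2) * sqnorm U)"
      using N t \<delta> by (intro add_mono mult_right_mono mult_left_mono sqnorm_nonneg) (auto simp: field_simps)
    also have "\<dots> = t * (\<delta> * sqnorm U)" by (simp add: algebra_simps)
    finally have "norm (integral I X) \<le> \<delta> * sqnorm U" using t by simp
    then show "norm (integral I (\<lambda>x. of_real (\<eta> x) * ((exp (- (s * of_real (L x))) * U (g x)) *
      cnj (exp (- (s * of_real (L x))) * U (- g x))))) \<le> \<delta> * sqnorm U"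
      by (simp only: X_def)
  qed
qed

end

section \<open>Fixed points of the transfer operator\<close>

context quadratic_interval
begin

section \<open>Energy estimates for fixed points\<close>

lemma sqnorm_eq_0D:
  assumes F: "continuous_on I F" and z: "sqnorm F \<le> 0" and x: "x \<in> I"
  shows "F x = 0"
proof -
  have "integral I (\<lambda>x. (norm (F x))\<^sup>2) = 0"
    using z sqnorm_nonneg[of F] by (simp add: sqnorm_def)
  moreover have "continuous_on I (\<lambda>x. (norm (F x))\<^sup>2)"
    by (intro continuous_intros F)
  ultimately have "(norm (F x))\<^sup>2 = 0"
    using integral_eq_0_iff[of "- b" b "\<lambda>x. (norm (F x))\<^sup>2"] b_pos x by simp
  then show ?thesis by simp
qed

lemma sq_fixed_le:
  assumes "transfer_fixed s U" "x \<in> I" "k \<le> 2 * Re s - 1"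
  shows "(norm (U x))\<^sup>2 \<le> exp (- (k * L x)) * (2 * push (\<lambda>y. (norm (U y))\<^sup>2) x)"
proof -
  have "(norm (U x))\<^sup>2 = (exp (- (Re s * L x)))\<^sup>2 * (norm (U (g x) + U (- g x)))\<^sup>2"
    using assms(1,2) by (simp add: transfer_fixed_def norm_mult power_mult_distrib)
  also have "\<dots> \<le> (exp (- (Re s * L x)))\<^sup>2 * (2 * ((norm (U (g x)))\<^sup>2 + (norm (U (- g x)))\<^sup>2))"
    by (intro mult_left_mono sq_norm_add_le) auto
  also have "\<dots> = exp (- ((2 * Re s - 1) * L x)) * (2 * push (\<lambda>y. (norm (U y))\<^sup>2) x)"
    by (simp only: sq_exp_half push_def mult_ac)
  also have "\<dots> \<le> exp (- (k * L x)) * (2 * push (\<lambda>y. (norm (U y))\<^sup>2) x)"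
    using assms(3) L_pos[OF assms(2)] push_nonneg[of "\<lambda>y. (norm (U y))\<^sup>2" x] assms(2)
    by (intro mult_right_mono) auto
  finally show ?thesis .
qed

lemma L_ge: "x \<in> I \<Longrightarrow> ln (11 / 5) \<le> L x"
  using g_gt[of x] by (simp add: L_def)

lemma cont_sq: "continuous_on I F \<Longrightarrow> continuous_on I (\<lambda>x. (norm (F x))\<^sup>2)"
  for F :: "real \<Rightarrow> complex"
  by (intro continuous_intros)

text \<open>A crude bound in which the cross term costs the factor 2. It is used with
  \<open>k = 0\<close> to control the full norm by the cut-off one, and with \<open>k = 1\<close> to
  settle \<open>Re s > 1\<close>.\<close>

lemma sqnorm_le_push:
  assumes U: "continuous_on I U" and fixed: "transfer_fixed s U" and k: "k \<le> 2 * Re s - 1" "0 \<le> k"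
  shows "sqnorm U \<le> 2 * exp (- (k * ln (11 / 5))) * integral I (push (\<lambda>y. (norm (U y))\<^sup>2))"
proof -
  have "sqnorm U \<le> integral I (\<lambda>x. 2 * exp (- (k * ln (11 / 5))) * push (\<lambda>y. (norm (U y))\<^sup>2) x)"
    unfolding sqnorm_def
  proof (rule integral_le)
    fix x assume x: "x \<in> I"
    have "(norm (U x))\<^sup>2 \<le> exp (- (k * L x)) * (2 * push (\<lambda>y. (norm (U y))\<^sup>2) x)"
      by (rule sq_fixed_le[OF fixed x k(1)])
    also have "\<dots> \<le> exp (- (k * ln (11 / 5))) * (2 * push (\<lambda>y. (norm (U y))\<^sup>2) x)"
      using L_ge[OF x] k push_nonneg[of "\<lambda>y. (norm (U y))\<^sup>2" x] x
      by (intro mult_right_mono) (auto intro: mult_left_mono)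
    finally show "(norm (U x))\<^sup>2 \<le> 2 * exp (- (k * ln (11 / 5))) * push (\<lambda>y. (norm (U y))\<^sup>2) x"
      by (simp only: mult_ac)
  qed (intro integrable_continuous_interval continuous_intros cont_push cont_sq U)+
  then show ?thesis by simp
qed

text \<open>Differentiating the fixed point equation gives one term in \<open>U'\<close> of the
  branch points, which is contracted and can be absorbed on the left, and one term of size
  \<open>norm s * norm U\<close>.\<close>

lemma derivative_sqnorm_le:
  assumes U: "C1 U U'" and R: "b < R"
    and fixed: "\<And>x. \<bar>x\<bar> < R \<Longrightarrow> U x = exp (- (s * of_real (L x))) * (U (g x) + U (- g x))"
    and s: "1 / 2 \<le> Re s"
  shows "sqnorm U' \<le> 6 * (norm s)\<^sup>2 * sqnorm U"
proof -
  let ?P = "\<lambda>y. (norm (U' y))\<^sup>2"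
  have cU: "continuous_on I U" "continuous_on I U'" using U C1_cont by (auto simp: C1_def)
  have dU: "(U has_vector_derivative U' y) (at y)" if "y \<in> I" for y
    using U that by (simp add: C1_def)
  have eq: "U' x = exp (- (s * of_real (L x))) * (of_real (1 / (2 * g x)) * (U' (g x) - U' (- g x)))
      + - (s * of_real (1 / (2 * (x - c))) * U x)" if x: "x \<in> I" for x
  proof -
    have e: "((\<lambda>x. exp (- (s * of_real (L x)))) has_vector_derivative
        of_real (1 / (2 * (x - c))) * (- s * exp (- (s * of_real (L x))))) (at x)"
    proof -
      have 1: "((\<lambda>x. complex_of_real (L x)) has_vector_derivative of_real (1 / (2 * (x - c)))) (at x)"
        by (intro has_vector_derivative_of_real DERIV_L x)
      have 2: "((\<lambda>z. exp (- (s * z))) has_field_derivative - s * exp (- (s * of_real (L x))))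
          (at (complex_of_real (L x)))"
        by (auto intro!: derivative_eq_intros)
      show ?thesis using field_vector_diff_chain_at[OF 1 2] by (simp add: o_def)
    qed
    have "((\<lambda>x. U (g x)) has_vector_derivative of_real (1 / (2 * g x)) * U' (g x)) (at x)"
      using has_vector_derivative_comp_G[OF U, of "[1]" x] x by simp
    moreover have "((\<lambda>x. U (- g x)) has_vector_derivative of_real (- 1 / (2 * g x)) * U' (- g x)) (at x)"
      using has_vector_derivative_comp_G[OF U, of "[- 1]" x] x by simp
    ultimately have d: "((\<lambda>x. exp (- (s * of_real (L x))) * (U (g x) + U (- g x))) has_vector_derivative
        exp (- (s * of_real (L x))) * (of_real (1 / (2 * g x)) * U' (g x) + of_real (- 1 / (2 * g x)) * U' (- g x))
        + of_real (1 / (2 * (x - c))) * (- s * exp (- (s * of_real (L x)))) * (U (g x) + U (- g x))) (at x)"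
      by (intro has_vector_derivative_mult has_vector_derivative_add e)
    \<comment> \<open>The equation holds on a neighbourhood of \<open>I\<close>, so both sides have
      the same two-sided derivative even at the end points.\<close>
    have "((\<lambda>x. exp (- (s * of_real (L x))) * (U (g x) + U (- g x))) has_vector_derivative U' x) (at x)"
      by (rule has_vector_derivative_transform_within_open[OF dU[OF x], of "{- R<..<R}"])
        (use x R fixed in auto)
    from vector_derivative_unique_at[OF this d]
    have "U' x = exp (- (s * of_real (L x))) * (of_real (1 / (2 * g x)) * U' (g x) + of_real (- 1 / (2 * g x)) * U' (- g x))
        + of_real (1 / (2 * (x - c))) * (- s * exp (- (s * of_real (L x)))) * (U (g x) + U (- g x))" .
    also have "complex_of_real (- 1 / (2 * g x)) = - of_real (1 / (2 * g x))"
      by simp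
    also have "E * (p * A + - p * B) + r * (- s * E) * V = E * (p * (A - B)) + - (s * r * (E * V))"
      for E p A B r V
      by (simp add: algebra_simps)
    also have "exp (- (s * of_real (L x))) * (U (g x) + U (- g x)) = U x"
      by (rule fixed[symmetric]) (use x R in auto)
    finally show ?thesis .
  qed
  \<comment> \<open>100/121 is 4 * (5/11)^2: a factor 2 for each of the two uses of
    \<open>sq_norm_add_le\<close>, and the square of the contraction rate.\<close>
  have ptwise: "?P x \<le> 100 / 121 * push ?P x + (norm s)\<^sup>2 * (norm (U x))\<^sup>2" if x: "x \<in> I" for x
  proof -
    let ?u = "exp (- (s * of_real (L x))) * (of_real (1 / (2 * g x)) * (U' (g x) - U' (- g x)))"
    have "(exp (- (Re s * L x)))\<^sup>2 \<le> exp (- L x)"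
      using sq_exp_half[of "Re s" "L x"] s L_pos[OF x] by simp
    moreover have "(1 / (2 * g x))\<^sup>2 \<le> (5 / 11)\<^sup>2"
      using weight_le[OF x] exp_L[OF x] g_gt[OF x] by (intro power_mono) auto
    moreover have "(norm (U' (g x) - U' (- g x)))\<^sup>2 \<le> 2 * (?P (g x) + ?P (- g x))"
      using sq_norm_add_le[of "U' (g x)" "- U' (- g x)"] by simp
    ultimately have "(exp (- (Re s * L x)))\<^sup>2 * ((1 / (2 * g x))\<^sup>2 * (norm (U' (g x) - U' (- g x)))\<^sup>2)
        \<le> exp (- L x) * ((5 / 11)\<^sup>2 * (2 * (?P (g x) + ?P (- g x))))"
      by (intro mult_mono) auto
    moreover have "(norm ?u)\<^sup>2 =
        (exp (- (Re s * L x)))\<^sup>2 * ((1 / (2 * g x))\<^sup>2 * (norm (U' (g x) - U' (- g x)))\<^sup>2)"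
      unfolding norm_mult norm_exp_L norm_of_real by (simp add: power_mult_distrib power_divide)
    ultimately have 1: "(norm ?u)\<^sup>2 \<le> 50 / 121 * push ?P x"
      by (simp add: push_def power2_eq_square algebra_simps)
    have "121 / 100 < x - c"
      using power_strict_mono[OF g_gt[OF x], of 2] g_sq[OF x] by (simp add: power2_eq_square)
    then have "(1 / (2 * (x - c)))\<^sup>2 \<le> (1 / 2)\<^sup>2" by (intro power_mono frac_le) auto
    then have "(1 / (2 * (x - c)))\<^sup>2 * ((norm s)\<^sup>2 * (norm (U x))\<^sup>2) \<le> (1 / 2)\<^sup>2 * ((norm s)\<^sup>2 * (norm (U x))\<^sup>2)"
      by (intro mult_right_mono) auto
    moreover have "(norm (- (s * of_real (1 / (2 * (x - c))) * U x)))\<^sup>2 =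
        (1 / (2 * (x - c)))\<^sup>2 * ((norm s)\<^sup>2 * (norm (U x))\<^sup>2)"
      unfolding norm_minus_cancel norm_mult norm_of_real power_mult_distrib power2_abs
      by (simp only: mult_ac)
    ultimately have 2: "(norm (- (s * of_real (1 / (2 * (x - c))) * U x)))\<^sup>2 \<le>
        (1 / 2)\<^sup>2 * ((norm s)\<^sup>2 * (norm (U x))\<^sup>2)" by (simp only:)
    have "?P x \<le> 2 * ((norm ?u)\<^sup>2 + (norm (- (s * of_real (1 / (2 * (x - c))) * U x)))\<^sup>2)"
      unfolding eq[OF x] by (rule sq_norm_add_le)
    also have "\<dots> \<le> 2 * (50 / 121 * push ?P x + (1 / 2)\<^sup>2 * ((norm s)\<^sup>2 * (norm (U x))\<^sup>2))"
      using 1 2 by (intro mult_left_mono add_mono) auto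
    also have "\<dots> \<le> 100 / 121 * push ?P x + (norm s)\<^sup>2 * (norm (U x))\<^sup>2"
      by (simp add: power2_eq_square)
    finally show ?thesis .
  qed
  have "sqnorm U' \<le> integral I (\<lambda>x. 100 / 121 * push ?P x + (norm s)\<^sup>2 * (norm (U x))\<^sup>2)"
    unfolding sqnorm_def
    by (rule integral_le[OF _ _ ptwise])
      (intro integrable_continuous_interval continuous_intros cont_push cont_sq cU)+
  also have "\<dots> = 100 / 121 * integral I (push ?P) + (norm s)\<^sup>2 * sqnorm U"
  proof -
    have "(\<lambda>x. k * f x) integrable_on I" if "continuous_on I f" for k :: real and f
      by (intro integrable_continuous_interval continuous_intros that)
    then show ?thesis
      by (simp only: sqnorm_def integral_add cont_push cont_sq cU integral_mult_right)
  qed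
  also have "\<dots> \<le> 100 / 121 * sqnorm U' + (norm s)\<^sup>2 * sqnorm U"
    using integral_push_le[OF cont_sq[OF cU(2)]] by (simp add: sqnorm_def)
  \<comment> \<open>Absorbing the first term leaves 121/21, which is below 6.\<close>
  finally have "21 * sqnorm U' \<le> 121 * ((norm s)\<^sup>2 * sqnorm U)" by simp
  moreover have "0 \<le> (norm s)\<^sup>2 * sqnorm U" by (simp add: sqnorm_nonneg)
  ultimately show ?thesis by linarith
qed

text \<open>Here the weight alone wins against the factor 2, as 2 * 5/11 < 1, and no oscillation is
  called for.\<close>

lemma fixed_eq_0_of_gt_1:
  assumes U: "continuous_on I U" and fixed: "transfer_fixed s U" and s: "1 < Re s" and x: "x \<in> I"
  shows "U x = 0"
proof (rule sqnorm_eq_0D[OF U _ x])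
  have "exp (- (1 * ln (11 / 5))) = (5 / 11 :: real)"
    by (simp add: exp_minus)
  moreover have "sqnorm U \<le> 2 * exp (- (1 * ln (11 / 5))) * integral I (push (\<lambda>y. (norm (U y))\<^sup>2))"
    using s by (intro sqnorm_le_push[OF U fixed]) auto
  ultimately have "sqnorm U \<le> 2 * (5 / 11) * integral I (push (\<lambda>y. (norm (U y))\<^sup>2))"
    by (simp only:)
  also have "\<dots> \<le> 2 * (5 / 11) * sqnorm U"
    unfolding sqnorm_def by (intro mult_left_mono integral_push_le cont_sq U) auto
  finally show "sqnorm U \<le> 0" by simp
qed

text \<open>For \<open>Re s \<le> 1\<close>, the cut-off squared norm \<open>n\<close> is bounded by
  \<open>\<rho> * n\<close> from the diagonal terms plus a cross term of at most
  \<open>4 * \<delta> * n\<close>. The sum is a proper fraction of \<open>n\<close>, so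
  \<open>n\<close> vanishes.\<close>

lemma fixed_eq_0:
  assumes R: "b < R" and \<epsilon>: "0 < \<epsilon>"
  shows "\<exists>T>0. \<forall>U U' s. C1 U U' \<longrightarrow>
    (\<forall>x. \<bar>x\<bar> < R \<longrightarrow> U x = exp (- (s * of_real (L x))) * (U (g x) + U (- g x))) \<longrightarrow>
    1 / 2 + \<epsilon> < Re s \<longrightarrow> T < \<bar>Im s\<bar> \<longrightarrow> (\<forall>x\<in>I. U x = 0)"
proof -
  obtain \<eta> \<eta>' where \<eta>: "\<And>x. (\<eta> has_real_derivative \<eta>' x) (at x)" "continuous_on UNIV \<eta>'"
    "\<And>x. \<bar>x\<bar> \<le> b \<Longrightarrow> 0 \<le> \<eta> x \<and> \<eta> x \<le> 1" "\<And>x. \<bar>x\<bar> \<le> M \<Longrightarrow> \<eta> x = 1"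
    "\<eta> b = 0" "\<eta> (- b) = 0"
    using C1_cutoff[of M b] mM m_pos by auto
  have c\<eta>: "continuous_on I \<eta>"
    using \<eta>(1) by (meson DERIV_isCont continuous_at_imp_continuous_on)
  \<comment> \<open>The gain \<open>exp (- ((2 * Re s - 1) * L x))\<close> at its weakest:
    \<open>Re s\<close> at \<open>1/2 + \<epsilon>\<close> and \<open>L x\<close> at its lower bound
    \<open>ln (11 / 5)\<close>.\<close>
  define \<rho> where "\<rho> = exp (- (2 * \<epsilon> * ln (11 / 5)))"
  have \<rho>: "\<rho> < 1" using \<epsilon> by (simp add: \<rho>_def)
  \<comment> \<open>The cross term enters twice and \<open>sqnorm U \<le> 2 * n\<close>, so it
    totals \<open>4 * \<delta> * n\<close>, half of the available gap
    \<open>(1 - \<rho>) * n\<close>.\<close>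
  define \<delta> where "\<delta> = (1 - \<rho>) / 8"
  have \<delta>: "0 < \<delta>" using \<rho> by (simp add: \<delta>_def)
  obtain T where T: "1 \<le> T" and cross: "\<And>U U' s. C1 U U' \<Longrightarrow> transfer_fixed s U \<Longrightarrow> 1 / 2 \<le> Re s \<Longrightarrow>
    Re s \<le> 1 \<Longrightarrow> T < \<bar>Im s\<bar> \<Longrightarrow> sqnorm U' \<le> 12 * (Im s)\<^sup>2 * sqnorm U \<Longrightarrow>
    norm (integral I (\<lambda>x. of_real (\<eta> x) * ((exp (- (s * of_real (L x))) * U (g x)) *
      cnj (exp (- (s * of_real (L x))) * U (- g x))))) \<le> \<delta> * sqnorm U"
    using cross_term_le[OF \<eta>(1,2,3,5,6) \<delta>] by blast
  show ?thesis
  proof (intro exI[of _ T] conjI allI impI ballI)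
    show "0 < T" using T by simp
    fix U U' s x
    assume U: "C1 U U'" and s: "1 / 2 + \<epsilon> < Re s" "T < \<bar>Im s\<bar>" and x: "x \<in> I"
      and eq: "\<forall>x. \<bar>x\<bar> < R \<longrightarrow> U x = exp (- (s * of_real (L x))) * (U (g x) + U (- g x))"
    have fixed: "transfer_fixed s U" using eq R by (auto simp: transfer_fixed_def)
    have cU: "continuous_on I U" by (rule C1_cont[OF U])
    show "U x = 0"
    proof (cases "1 < Re s")
      case True
      then show ?thesis by (rule fixed_eq_0_of_gt_1[OF cU fixed _ x])
    next
      case False
      let ?P = "\<lambda>y. (norm (U y))\<^sup>2"
      have P: "continuous_on I ?P" by (rule cont_sq[OF cU])
      define n where "n = integral I (\<lambda>x. \<eta> x * ?P x)"
      define Y Z where "Y = (\<lambda>x. exp (- (s * of_real (L x))) * U (g x))"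
        and "Z = (\<lambda>x. exp (- (s * of_real (L x))) * U (- g x))"
      have cYZ: "continuous_on I Y" "continuous_on I Z"
        unfolding Y_def Z_def using cont_comp_g[OF cU, of 1] cont_comp_g[OF cU, of "- 1"]
        by (auto intro!: continuous_on_mult continuous_on_exp continuous_on_minus continuous_on_of_real
            continuous_on_const cont_L)
      \<comment> \<open>With \<open>Re s \<le> 1 < \<bar>Im s\<bar>\<close>, the constant 6 of the
        derivative bound in \<open>norm s\<close> becomes 12 in \<open>Im s\<close>.\<close>
      have "1 < (Im s)\<^sup>2"
        using s T power_strict_mono[of 1 "\<bar>Im s\<bar>" 2] by simp
      moreover have "(Re s)\<^sup>2 \<le> 1" using False s \<epsilon> by (intro power_le_one) auto
      ultimately have "(norm s)\<^sup>2 \<le> 2 * (Im s)\<^sup>2" by (simp add: cmod_power2)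
      then have "6 * (norm s)\<^sup>2 * sqnorm U \<le> 12 * (Im s)\<^sup>2 * sqnorm U"
        by (intro mult_right_mono sqnorm_nonneg) auto
      moreover have "sqnorm U' \<le> 6 * (norm s)\<^sup>2 * sqnorm U"
        by (rule derivative_sqnorm_le[OF U R]) (use eq s \<epsilon> in auto)
      ultimately have "sqnorm U' \<le> 12 * (Im s)\<^sup>2 * sqnorm U" by (rule order_trans[rotated])
      then have X: "norm (integral I (\<lambda>x. of_real (\<eta> x) * (Y x * cnj (Z x)))) \<le> \<delta> * sqnorm U"
        unfolding Y_def Z_def using False s \<epsilon> by (intro cross[OF U fixed]) auto
      have push_n: "integral I (push ?P) \<le> n"
        unfolding n_def using \<eta>(3,4) by (intro integral_push_le_cutoff P c\<eta>) auto
      have norm_n: "sqnorm U \<le> 2 * n"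
      proof -
        have "sqnorm U \<le> 2 * exp (- (0 * ln (11 / 5))) * integral I (push ?P)"
          using s \<epsilon> by (intro sqnorm_le_push[OF cU fixed]) auto
        then show ?thesis using push_n by simp
      qed
      have i1: "(\<lambda>x. \<rho> * push ?P x) integrable_on I"
        by (intro integrable_continuous_interval continuous_on_mult continuous_on_const cont_push P)
      have "continuous_on I (\<lambda>x. of_real (\<eta> x) * (Y x * cnj (Z x)))"
        by (intro continuous_on_mult continuous_on_of_real continuous_on_cnj c\<eta> cYZ)
      then have i2: "(\<lambda>x. of_real (\<eta> x) * (Y x * cnj (Z x))) integrable_on I"
        by (rule integrable_continuous_interval)
      have i3: "(\<lambda>x. Re (of_real (\<eta> x) * (Y x * cnj (Z x)))) integrable_on I"
        using integrable_linear[OF i2 bounded_linear_Re] by (simp add: o_def)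
      have "n \<le> integral I (\<lambda>x. \<rho> * push ?P x + 2 * Re (of_real (\<eta> x) * (Y x * cnj (Z x))))"
        unfolding n_def
      proof (rule integral_le)
        show "(\<lambda>x. \<eta> x * ?P x) integrable_on I"
          by (intro integrable_continuous_interval continuous_on_mult c\<eta> P)
        show "(\<lambda>x. \<rho> * push ?P x + 2 * Re (of_real (\<eta> x) * (Y x * cnj (Z x)))) integrable_on I"
          by (intro integrable_add i1 integrable_on_mult_right i3)
        fix x assume x: "x \<in> I"
        have \<eta>x: "0 \<le> \<eta> x" "\<eta> x \<le> 1" using \<eta>(3)[of x] x by auto
        have "U x = Y x + Z x"
          using fixed x by (simp add: transfer_fixed_def Y_def Z_def distrib_left)
        then have "?P x = (norm (Y x))\<^sup>2 + (norm (Z x))\<^sup>2 + 2 * Re (Y x * cnj (Z x))"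
          unfolding cmod_power2 by (simp add: power2_eq_square algebra_simps)
        moreover have "(norm (Y x))\<^sup>2 + (norm (Z x))\<^sup>2 = exp (- ((2 * Re s - 1) * L x)) * push ?P x"
          unfolding Y_def Z_def norm_mult norm_exp_L power_mult_distrib sq_exp_half push_def
          by (simp only: distrib_left mult.assoc)
        moreover have "exp (- ((2 * Re s - 1) * L x)) \<le> \<rho>"
        proof -
          have "2 * \<epsilon> * ln (11 / 5) \<le> (2 * Re s - 1) * L x"
            using s \<epsilon> L_ge[OF x] by (intro mult_mono) auto
          then show ?thesis by (simp add: \<rho>_def)
        qed
        moreover have "0 \<le> push ?P x" using x by (intro push_nonneg) auto
        ultimately have "?P x \<le> \<rho> * push ?P x + 2 * Re (Y x * cnj (Z x))"
          using mult_right_mono by fastforce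
        then have "\<eta> x * ?P x \<le> \<eta> x * (\<rho> * push ?P x + 2 * Re (Y x * cnj (Z x)))"
          using \<eta>x by (intro mult_left_mono)
        also have "\<dots> = \<eta> x * (\<rho> * push ?P x) + 2 * Re (of_real (\<eta> x) * (Y x * cnj (Z x)))"
          by (simp add: algebra_simps)
        also have "\<eta> x * (\<rho> * push ?P x) \<le> 1 * (\<rho> * push ?P x)"
          using \<eta>x \<open>0 \<le> push ?P x\<close> by (intro mult_right_mono) (auto simp: \<rho>_def)
        finally show "\<eta> x * ?P x \<le> \<rho> * push ?P x + 2 * Re (of_real (\<eta> x) * (Y x * cnj (Z x)))"
          by simp
      qed
      also have "\<dots> = \<rho> * integral I (push ?P) + 2 * integral I (\<lambda>x. Re (of_real (\<eta> x) * (Y x * cnj (Z x))))"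
        using i1 i3 by (simp only: integral_add integral_mult_right integrable_on_mult_right)
      also have "integral I (\<lambda>x. Re (of_real (\<eta> x) * (Y x * cnj (Z x)))) =
          Re (integral I (\<lambda>x. of_real (\<eta> x) * (Y x * cnj (Z x))))"
        using integral_linear[OF i2 bounded_linear_Re] by (simp only: o_def)
      also have "\<dots> \<le> \<delta> * sqnorm U"
        using complex_Re_le_cmod X by (rule order_trans)
      finally have "n \<le> \<rho> * integral I (push ?P) + 2 * (\<delta> * sqnorm U)" by simp
      also have "\<dots> \<le> \<rho> * n + 2 * (\<delta> * (2 * n))"
        using push_n norm_n \<delta> by (intro add_mono mult_left_mono) (auto simp: \<rho>_def)
      also have "2 * (\<delta> * (2 * n)) = (n - \<rho> * n) / 2" by (simp add: \<delta>_def field_simps)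
      finally have "n - \<rho> * n \<le> 0" by argo
      then have "(1 - \<rho>) * n \<le> 0" by (simp add: left_diff_distrib)
      then have "n \<le> 0" using \<rho> by (simp add: mult_le_0_iff)
      then show ?thesis using norm_n by (intro sqnorm_eq_0D[OF cU _ x]) simp
    qed
  qed
qed

section \<open>From the Bergman space to the real interval\<close>

lemma inv_branch_of_real:
  assumes "c < x"
  shows "inv_branch c Plus (of_real x) = of_real (g x)" "inv_branch c Minus (of_real x) = of_real (- g x)"
    "Ln (ext_abs_deriv c i (of_real x)) = - of_real (L x)"
proof -
  have sq: "csqrt (of_real x - of_real c) = of_real (g x)"
    using assms of_real_sqrt[of "x - c"] by (simp add: g_def)
  then show "inv_branch c Plus (of_real x) = of_real (g x)" "inv_branch c Minus (of_real x) = of_real (- g x)"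
    by simp_all
  have "0 < g x" using assms by (simp add: g_def)
  then have "Ln (complex_of_real (1 / (2 * g x))) = of_real (ln (1 / (2 * g x)))"
    by (intro Ln_of_real) simp
  then show "Ln (ext_abs_deriv c i (of_real x)) = - of_real (L x)"
    using \<open>0 < g x\<close> by (simp add: ext_abs_deriv_def sq L_def ln_div)
qed

end

text \<open>Squaring shows that \<open>zeta_fix c < - 2 * c / 3\<close> amounts to
  \<open>c < - 15 / 4\<close>, which is where the hypothesis on \<open>c\<close> enters.\<close>

lemma obtain_interval:
  fixes c R :: real
  assumes c: "c < - 3.75" and R: "zeta_fix c < R"
  obtains b where "quadratic_interval c b" "b < R"
proof -
  \<comment> \<open>The midpoint between the fixed point and the smaller of the two upper limits for
    \<open>b\<close>.\<close>
  define b where "b = (zeta_fix c + min R (- 2 * c / 3)) / 2"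
  have "1 - 4 * c < (- 4 * c / 3 - 1)\<^sup>2"
  proof -
    have "15 / 4 * (- c) < (- c) * (- c)" using c by (intro mult_strict_right_mono) auto
    then show ?thesis by (simp add: power2_eq_square algebra_simps)
  qed
  then have "sqrt (1 - 4 * c) < - 4 * c / 3 - 1"
    using c by (intro real_less_lsqrt) auto
  then have "zeta_fix c < - 2 * c / 3" by (simp add: zeta_fix_def)
  then have b: "zeta_fix c < b" "b < R" "b \<le> - 2 * c / 3" using R by (auto simp: b_def)
  have sq: "0 \<le> sqrt (1 - 4 * c)" "sqrt (1 - 4 * c) < 2 * b - 1"
    using b(1) c by (simp_all add: zeta_fix_def)
  have "0 < b" using sq by linarith
  have "(sqrt (1 - 4 * c))\<^sup>2 < (2 * b - 1)\<^sup>2"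
    using sq by (intro power_strict_mono) auto
  then have "b - c < b\<^sup>2" using c by (simp add: power2_eq_square algebra_simps)
  with \<open>0 < b\<close> b c have "quadratic_interval c b" by unfold_locales auto
  with b(2) show ?thesis using that by blast
qed

text \<open>The branches map the whole disc into \<open>branch_dom c R\<close>, so the formula for
  the operator defines a holomorphic function on the disc. This yields a connected domain that
  contains \<open>I\<close>, whereas \<open>branch_dom c R\<close> is disconnected and omits
  0.\<close>

lemma transfer_fixed_extension:
  assumes R: "R < - c" and u: "u \<in> bergman_space c R" and fixed: "transfer_op c R s u = u"
  obtains v where "v holomorphic_on ball 0 R" "\<And>z. z \<in> branch_dom c R \<Longrightarrow> u z = v z"
    "\<And>z. z \<in> ball 0 R \<Longrightarrow> v z = (\<Sum>i\<in>{Plus, Minus}.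
      exp (s * Ln (ext_abs_deriv c i z)) * v (inv_branch c i z))"
proof -
  let ?D = "branch_dom c R"
  define v where "v z = (\<Sum>i\<in>{Plus, Minus}. exp (s * Ln (ext_abs_deriv c i z)) * u (inv_branch c i z))" for z
  have img: "inv_branch c i ` ball 0 R \<subseteq> ?D" for i
    by (cases i) (auto simp: branch_dom_def branch_disc_def)
  have uhol: "u holomorphic_on ?D" using u by (simp add: bergman_space_def)
  have comp: "(\<lambda>z. u (inv_branch c i z)) holomorphic_on ball 0 R" for i
    using holomorphic_on_compose_gen[OF inv_branch_holomorphic[OF R] uhol img]
    by (simp add: o_def)
  have vhol: "v holomorphic_on ball 0 R"
    unfolding v_def
    using Re_ext_abs_deriv_pos[OF R]
    by (intro holomorphic_intros comp ext_abs_deriv_holomorphic[OF R] Re_pos_not_nonpos) auto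
  have uv: "u z = v z" if "z \<in> ?D" for z
    using fun_cong[OF fixed, of z] that by (simp add: transfer_op_def v_def)
  show ?thesis
  proof (rule that[OF vhol uv])
    fix z :: complex assume "z \<in> ball 0 R"
    then have "u (inv_branch c i z) = v (inv_branch c i z)" for i using img uv by blast
    then show "v z = (\<Sum>i\<in>{Plus, Minus}. exp (s * Ln (ext_abs_deriv c i z)) * v (inv_branch c i z))"
      unfolding v_def[of z] by (simp only:)
  qed
qed

theorem theorem1p1:
  fixes c R \<epsilon> :: real
  assumes "c < - 3.75" and "zeta_fix c < R" and "R < - c" and "\<epsilon> > 0"
  shows "\<exists>M>0. \<forall>s::complex. Re s > 1/2 + \<epsilon> \<and> \<bar>Im s\<bar> > M \<longrightarrow>
    (\<forall>u\<in>bergman_space c R. transfer_op c R s u = u \<longrightarrow> u = (\<lambda>_. 0))"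
proof -
  obtain b where "quadratic_interval c b" and bR: "b < R"
    using obtain_interval[OF assms(1,2)] .
  then interpret quadratic_interval c b by simp
  obtain T where "0 < T" and T: "\<And>U U' s x. C1 U U' \<Longrightarrow>
    (\<And>x. \<bar>x\<bar> < R \<Longrightarrow> U x = exp (- (s * of_real (L x))) * (U (g x) + U (- g x))) \<Longrightarrow>
    1 / 2 + \<epsilon> < Re s \<Longrightarrow> T < \<bar>Im s\<bar> \<Longrightarrow> x \<in> I \<Longrightarrow> U x = 0"
    using fixed_eq_0[OF bR assms(4)] by blast
  show ?thesis
  proof (intro exI[of _ T] conjI allI impI ballI \<open>0 < T\<close> ext)
    fix s :: complex and u z
    assume s: "1 / 2 + \<epsilon> < Re s \<and> T < \<bar>Im s\<bar>" and u: "u \<in> bergman_space c R"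
      and fixed: "transfer_op c R s u = u"
    obtain v where v: "v holomorphic_on ball 0 R" and uv: "\<And>z. z \<in> branch_dom c R \<Longrightarrow> u z = v z"
      and v_eq: "\<And>z. z \<in> ball 0 R \<Longrightarrow> v z = (\<Sum>i\<in>{Plus, Minus}.
        exp (s * Ln (ext_abs_deriv c i z)) * v (inv_branch c i z))"
      using transfer_fixed_extension[OF assms(3) u fixed] by blast
    have in_ball: "complex_of_real x \<in> ball 0 R" if "x \<in> I" for x
      using that bR by auto
    have zero: "v (of_real x) = 0" if "x \<in> I" for x
    proof (rule T[where U = "\<lambda>x. v (of_real x)" and U' = "\<lambda>x. deriv v (of_real x)" and s = s])
      show "C1 (\<lambda>x. v (of_real x)) (\<lambda>x. deriv v (of_real x))"
        unfolding C1_def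
      proof (intro conjI ballI)
        fix x assume "x \<in> I"
        show "((\<lambda>x. v (of_real x)) has_vector_derivative deriv v (of_real x)) (at x)"
          by (intro has_vector_derivative_real_field holomorphic_derivI[OF v open_ball in_ball[OF \<open>x \<in> I\<close>]])
      next
        have "continuous_on (ball 0 R) (deriv v)"
          using v by (intro holomorphic_on_imp_continuous_on holomorphic_deriv) auto
        then show "continuous_on I (\<lambda>x. deriv v (of_real x))"
          by (rule continuous_on_compose2) (use in_ball in \<open>auto intro!: continuous_on_of_real continuous_on_id\<close>)
      qed
      fix y :: real assume y: "\<bar>y\<bar> < R"
      then have "c < y" and yb: "complex_of_real y \<in> ball 0 R" using assms(3) by auto
      show "v (of_real y) = exp (- (s * of_real (L y))) * (v (of_real (g y)) + v (of_real (- g y)))"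
        by (subst v_eq[OF yb]) (simp add: inv_branch_of_real[OF \<open>c < y\<close>] distrib_left del: inv_branch.simps)
    qed (use s that in auto)
    \<comment> \<open>The zeros of \<open>v\<close> on \<open>I\<close> accumulate at the centre of
      the disc, so the identity theorem applies.\<close>
    have lim: "(0::complex) islimpt of_real ` I"
      unfolding islimpt_approachable
    proof (intro allI impI)
      fix e :: real assume "0 < e"
      then show "\<exists>x'\<in>complex_of_real ` I. x' \<noteq> 0 \<and> dist x' 0 < e"
        using b_pos by (intro bexI[of _ "of_real (min b (e / 2))"]) (auto simp: min_def)
    qed
    have "v w = 0" if "w \<in> ball 0 R" for w
      by (rule analytic_continuation[OF v open_ball connected_ball _ _ lim _ that])
        (use in_ball zero bR b_pos in auto)
    moreover have "branch_dom c R \<subseteq> ball 0 R"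
    proof -
      obtain r where "r < R" "branch_dom c R \<subseteq> cball 0 r"
        using branch_dom_radius[OF _ assms(2,3)] assms(1) by force
      moreover from \<open>r < R\<close> have "cball 0 r \<subseteq> ball (0 :: complex) R" by auto
      ultimately show ?thesis by blast
    qed
    \<comment> \<open>Off \<open>branch_dom c R\<close> the value is 0 by the normalisation in
      \<open>bergman_space\<close>.\<close>
    ultimately show "u z = 0"
      using uv[of z] u by (cases "z \<in> branch_dom c R") (auto simp: bergman_space_def)
  qed
qed

end
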